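(* Let $R$ be a commutative noetherian integral domain. The group $K^{\mathrm{A}}_{0}(R)$ contains a canonical infinite cyclic subgroup, generated by the element $[\Xi R]$ represented by the chain complex $\Xi R$; that is, the subgroup of $K^{\mathrm A}_0(R)$ generated by $[\Xi R]$ is infinite cyclic.
   Context: $\mathbb{N}$ includes $0$. $R$ is a commutative noetherian integral domain with field of quotients $Q$; the rank of an $R$-module $M$ is $\mathrm{rank}\,M=\dim_Q (M\otimes_R Q)$. All chain complexes are complexes of $R$-modules with differentials $C_{n}\to C_{n-1}$ and are positive: $C_n=0$ for $n<0$. For a sequence $\mathbf a=(a_n)_{n\in\mathbb N}$ of real numbers put $\bar\chi(\mathbf a)=\sum_{k\ge 0}a_kx^k$, and let $|\mathbf a|=(|a_n|)_n$. The sequence $\mathbf a$ is an Abel sequence if its power series $\bar\chi(\mathbf a)$ has radius of convergence at least $1$ and $\lim_{x\to1^-}(1-x)\bar\chi(\mathbf a)$ exists as a finite real number. It is of controlled absolute growth if its power series has radius of convergence at least $1$ and $(1-x)^2\,\bar\chi(|\mathbf a|)\to0$ as $x\to1^-$. For a positive chain complex $C$ whose homology modules all have finite rank, $\mathbf HC$ is the sequence $(\mathbf HC)_n=(-1)^n\,\mathrm{rank}\,H_nC$. $C$ is an Abel complex if $\mathbf HC$ is an Abel sequence, and is of controlled absolute growth if $\mathbf HC$ is. $\mathcal C_{\mathrm A}(R)$ is the category of all Abel complexes of controlled absolute growth and all chain maps between them. It is a category with cofibrations (injective chain maps) and weak equivalences (quasi-isomorphisms) in the sense of Waldhausen, and $K^{\mathrm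 A}_0(R)=\pi_0\,\Omega|w\mathcal S_\bullet\mathcal C_{\mathrm A}(R)|$ is its zeroth $K$-group. Explicitly, $K^{\mathrm A}_0(R)$ is the abelian group generated by symbols $[A]$ for each object $A$ of $\mathcal C_{\mathrm A}(R)$, subject to the relations $[A]=[A']$ whenever there is a weak equivalence $A\to A'$, and $[B]=[A]+[\mathrm{coker}(f)]$ for each cofibration $f\colon A\to B$. For a bounded positive chain complex $C$ with finitely generated homology modules, $\Xi C=\bigoplus_{k\ge0}C[2k]$, where $C[2k]$ is $C$ shifted up by $2k$ degrees (so $C[2k]_n=C_{n-2k}$). Regarding $R$ as a chain complex concentrated in degree $0$, the complex $\Xi R$ has chain module $R$ in every even degree $\ge 0$ and $0$ in every odd degree (hence zero differentials); it is an object of $\mathcal C_{\mathrm A}(R)$. *)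

theory Defs
  imports
    "Jordan_Normal_Form.Missing_VectorSpace"
    "HOL-Algebra.Algebra"
    "HOL-Analysis.Analysis"
begin

text \<open>A \<open>module\<close> record extends a \<open>ring\<close> record; the locale \<open>module\<close> ignores the
  fields \<open>mult\<close> and \<open>one\<close>, so they are filled arbitrarily.\<close>

definition quotient_module :: "('a, 'm, 'e) module_scheme \<Rightarrow> 'm set \<Rightarrow> ('a, 'm set) module" where
  "quotient_module M N =
     \<lparr>carrier = a_rcosets\<^bsub>M\<^esub> N, monoid.mult = (\<lambda>_ _. N), monoid.one = N,
      ring.zero = N, ring.add = set_add M,
      module.smult = (\<lambda>r S. \<Union>x\<in>S. N +>\<^bsub>M\<^esub> (r \<odot>\<^bsub>M\<^esub> x))\<rparr>"

definition fraction :: "('a, 'z) ring_scheme \<Rightarrow> 'a \<Rightarrow> 'a \<Rightarrow> ('a \<times> 'a) set" where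
  "fraction R a b =
     {(c, d). c \<in> carrier R \<and> d \<in> carrier R - {\<zero>\<^bsub>R\<^esub>} \<and> a \<otimes>\<^bsub>R\<^esub> d = c \<otimes>\<^bsub>R\<^esub> b}"

definition quotient_field :: "('a, 'z) ring_scheme \<Rightarrow> ('a \<times> 'a) set ring" where
  "quotient_field R =
     \<lparr>carrier = {fraction R a b | a b. a \<in> carrier R \<and> b \<in> carrier R - {\<zero>\<^bsub>R\<^esub>}},
      monoid.mult = (\<lambda>S T. \<Union>(a, b)\<in>S. \<Union>(c, d)\<in>T. fraction R (a \<otimes>\<^bsub>R\<^esub> c) (b \<otimes>\<^bsub>R\<^esub> d)),
      monoid.one = fraction R \<one>\<^bsub>R\<^esub> \<one>\<^bsub>R\<^esub>,
      ring.zero = fraction R \<zero>\<^bsub>R\<^esub> \<one>\<^bsub>R\<^esub>,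
      ring.add = (\<lambda>S T. \<Union>(a, b)\<in>S. \<Union>(c, d)\<in>T.
               fraction R ((a \<otimes>\<^bsub>R\<^esub> d) \<oplus>\<^bsub>R\<^esub> (c \<otimes>\<^bsub>R\<^esub> b)) (b \<otimes>\<^bsub>R\<^esub> d))\<rparr>"

text \<open>The \<open>Q\<close>-vector space \<open>M \<otimes>\<^sub>R Q\<close> is the quotient of the free abelian group on
  \<open>M \<times> Q\<close> by the subgroup generated by the usual bilinearity relations. The field \<open>Q\<close>
  acts on generators by \<open>q \<cdot> (x, p) = (x, q p)\<close>; this satisfies the module laws only after
  passing to the quotient.\<close>

definition tensor_free :: "('a, 'z) ring_scheme \<Rightarrow> ('a, 'm, 'e) module_scheme
    \<Rightarrow> (('a \<times> 'a) set, ('m \<times> ('a \<times> 'a) set) \<Rightarrow>\<^sub>0 int) module" where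
  "tensor_free R M =
     \<lparr>carrier = carrier (free_Abelian_group (carrier M \<times> carrier (quotient_field R))),
      monoid.mult = (\<lambda>_ _. 0), monoid.one = 0, ring.zero = 0, ring.add = (+),
      module.smult = (\<lambda>q. frag_extend (\<lambda>(x, p). frag_of (x, q \<otimes>\<^bsub>quotient_field R\<^esub> p)))\<rparr>"

definition tensor_relations :: "('a, 'z) ring_scheme \<Rightarrow> ('a, 'm, 'e) module_scheme
    \<Rightarrow> (('m \<times> ('a \<times> 'a) set) \<Rightarrow>\<^sub>0 int) set" where
  "tensor_relations R M =
     {frag_of (x \<oplus>\<^bsub>M\<^esub> y, p) - (frag_of (x, p) + frag_of (y, p)) | x y p.
        x \<in> carrier M \<and> y \<in> carrier M \<and> p \<in> carrier (quotient_field R)} \<union>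
     {frag_of (x, p \<oplus>\<^bsub>quotient_field R\<^esub> q) - (frag_of (x, p) + frag_of (x, q)) | x p q.
        x \<in> carrier M \<and> p \<in> carrier (quotient_field R) \<and> q \<in> carrier (quotient_field R)} \<union>
     {frag_of (r \<odot>\<^bsub>M\<^esub> x, p) - frag_of (x, fraction R r \<one>\<^bsub>R\<^esub> \<otimes>\<^bsub>quotient_field R\<^esub> p) | r x p.
        r \<in> carrier R \<and> x \<in> carrier M \<and> p \<in> carrier (quotient_field R)}"

definition tensor_quotient_field :: "('a, 'z) ring_scheme \<Rightarrow> ('a, 'm, 'e) module_scheme
    \<Rightarrow> (('a \<times> 'a) set, (('m \<times> ('a \<times> 'a) set) \<Rightarrow>\<^sub>0 int) set) module" where
  "tensor_quotient_field R M =
     quotient_module (tensor_free R M)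
       (generate (free_Abelian_group (carrier M \<times> carrier (quotient_field R)))
          (tensor_relations R M))"

definition has_finite_rank :: "('a, 'z) ring_scheme \<Rightarrow> ('a, 'm, 'e) module_scheme \<Rightarrow> bool" where
  "has_finite_rank R M \<longleftrightarrow> vectorspace.fin_dim (quotient_field R) (tensor_quotient_field R M)"

text \<open>Meaningful only if \<open>has_finite_rank R M\<close>.\<close>

definition module_rank :: "('a, 'z) ring_scheme \<Rightarrow> ('a, 'm, 'e) module_scheme \<Rightarrow> nat" where
  "module_rank R M = vectorspace.dim (quotient_field R) (tensor_quotient_field R M)"

text \<open>\<open>differential C n\<close> maps \<open>C\<^sub>n\<close> to \<open>C\<^bsub>n-1\<^esub>\<close> for \<open>n \<ge> 1\<close>. As \<open>C\<^bsub>-1\<^esub> = 0\<close>, the value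
  \<open>differential C 0\<close> is never used.\<close>

record ('a, 'm) chain_complex =
  chain_module :: "nat \<Rightarrow> ('a, 'm) module"
  differential :: "nat \<Rightarrow> 'm \<Rightarrow> 'm"

definition is_chain_complex :: "('a, 'z) ring_scheme \<Rightarrow> ('a, 'm) chain_complex \<Rightarrow> bool" where
  "is_chain_complex R C \<longleftrightarrow>
     (\<forall>n. Module.module R (chain_module C n)) \<and>
     (\<forall>n. differential C (Suc n)
        \<in> LinearCombinations.module_hom R (chain_module C (Suc n)) (chain_module C n)) \<and>
     (\<forall>n. \<forall>x\<in>carrier (chain_module C (Suc (Suc n))).
        differential C (Suc n) (differential C (Suc (Suc n)) x) = \<zero>\<^bsub>chain_module C n\<^esub>)"

definition cycles :: "('a, 'm) chain_complex \<Rightarrow> nat \<Rightarrow> 'm set" where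
  "cycles C n = (case n of
       0 \<Rightarrow> carrier (chain_module C 0)
     | Suc k \<Rightarrow> a_kernel (chain_module C (Suc k)) (chain_module C k) (differential C (Suc k)))"

definition boundaries :: "('a, 'm) chain_complex \<Rightarrow> nat \<Rightarrow> 'm set" where
  "boundaries C n = differential C (Suc n) ` carrier (chain_module C (Suc n))"

definition homology :: "('a, 'm) chain_complex \<Rightarrow> nat \<Rightarrow> ('a, 'm set) module" where
  "homology C n = quotient_module ((chain_module C n)\<lparr>carrier := cycles C n\<rparr>) (boundaries C n)"

definition chain_map :: "('a, 'z) ring_scheme \<Rightarrow> ('a, 'm) chain_complex
    \<Rightarrow> ('a, 'n) chain_complex \<Rightarrow> (nat \<Rightarrow> 'm \<Rightarrow> 'n) \<Rightarrow> bool" where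
  "chain_map R A B f \<longleftrightarrow>
     (\<forall>n. f n \<in> LinearCombinations.module_hom R (chain_module A n) (chain_module B n)) \<and>
     (\<forall>n. \<forall>x\<in>carrier (chain_module A (Suc n)).
        f n (differential A (Suc n) x) = differential B (Suc n) (f (Suc n) x))"

definition homology_map :: "('a, 'n) chain_complex \<Rightarrow> (nat \<Rightarrow> 'm \<Rightarrow> 'n)
    \<Rightarrow> nat \<Rightarrow> 'm set \<Rightarrow> 'n set" where
  "homology_map B f n S = (\<Union>x\<in>S. boundaries B n +>\<^bsub>chain_module B n\<^esub> f n x)"

definition quasi_isomorphism :: "('a, 'z) ring_scheme \<Rightarrow> ('a, 'm) chain_complex
    \<Rightarrow> ('a, 'n) chain_complex \<Rightarrow> (nat \<Rightarrow> 'm \<Rightarrow> 'n) \<Rightarrow> bool" where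
  "quasi_isomorphism R A B f \<longleftrightarrow> chain_map R A B f \<and>
     (\<forall>n. bij_betw (homology_map B f n) (carrier (homology A n)) (carrier (homology B n)))"

definition cofibration :: "('a, 'z) ring_scheme \<Rightarrow> ('a, 'm) chain_complex
    \<Rightarrow> ('a, 'n) chain_complex \<Rightarrow> (nat \<Rightarrow> 'm \<Rightarrow> 'n) \<Rightarrow> bool" where
  "cofibration R A B f \<longleftrightarrow>
     chain_map R A B f \<and> (\<forall>n. inj_on (f n) (carrier (chain_module A n)))"

definition chain_isomorphism :: "('a, 'z) ring_scheme \<Rightarrow> ('a, 'm) chain_complex
    \<Rightarrow> ('a, 'n) chain_complex \<Rightarrow> (nat \<Rightarrow> 'm \<Rightarrow> 'n) \<Rightarrow> bool" where
  "chain_isomorphism R A B f \<longleftrightarrow> chain_map R A B f \<and>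
     (\<forall>n. bij_betw (f n) (carrier (chain_module A n)) (carrier (chain_module B n)))"

definition cokernel :: "('a, 'm) chain_complex \<Rightarrow> ('a, 'n) chain_complex
    \<Rightarrow> (nat \<Rightarrow> 'm \<Rightarrow> 'n) \<Rightarrow> ('a, 'n set) chain_complex" where
  "cokernel A B f =
     \<lparr>chain_module = (\<lambda>n. quotient_module (chain_module B n) (f n ` carrier (chain_module A n))),
      differential = (\<lambda>n S. \<Union>x\<in>S.
        (f (n - 1) ` carrier (chain_module A (n - 1))) +>\<^bsub>chain_module B (n - 1)\<^esub>
          differential B n x)\<rparr>"

definition abel_sequence :: "(nat \<Rightarrow> real) \<Rightarrow> bool" where
  "abel_sequence a \<longleftrightarrow> conv_radius a \<ge> 1 \<and>
     (\<exists>l. ((\<lambda>x. (1 - x) * suminf (\<lambda>k. a k * x ^ k)) \<longlongrightarrow> l) (at_left 1))"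

definition controlled_absolute_growth :: "(nat \<Rightarrow> real) \<Rightarrow> bool" where
  "controlled_absolute_growth a \<longleftrightarrow> conv_radius a \<ge> 1 \<and>
     ((\<lambda>x. (1 - x)\<^sup>2 * suminf (\<lambda>k. \<bar>a k\<bar> * x ^ k)) \<longlongrightarrow> 0) (at_left 1)"

definition homology_sequence :: "('a, 'z) ring_scheme \<Rightarrow> ('a, 'm) chain_complex \<Rightarrow> nat \<Rightarrow> real" where
  "homology_sequence R C n = (-1) ^ n * real (module_rank R (homology C n))"

definition abel_complexes :: "('a, 'z) ring_scheme \<Rightarrow> ('a, 'm) chain_complex set" where
  "abel_complexes R = {C. is_chain_complex R C \<and> (\<forall>n. has_finite_rank R (homology C n)) \<and>
     abel_sequence (homology_sequence R C) \<and>
     controlled_absolute_growth (homology_sequence R C)}"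

text \<open>The type \<open>'m\<close> plays the role of the universe: the objects are the complexes all of whose
  chain modules have carriers in \<open>'m\<close>. The literal cokernel of a cofibration has carriers in
  \<open>'m set\<close>, so the relation for a cofibration is imposed for every object that is isomorphic
  to the cokernel. There always is such an object, since a quotient of a module in \<open>'m\<close> can be
  carried by a set of coset representatives; all of them have the same class, since
  isomorphisms are quasi-isomorphisms.\<close>

definition K0_relations :: "('a, 'z) ring_scheme \<Rightarrow> (('a, 'm) chain_complex \<Rightarrow>\<^sub>0 int) set" where
  "K0_relations R =
     {frag_of A - frag_of A' | A A'. A \<in> abel_complexes R \<and> A' \<in> abel_complexes R \<and>
        (\<exists>f. quasi_isomorphism R A A' f)} \<union>
     {frag_of B - (frag_of A + frag_of C) | A B C.
        A \<in> abel_complexes R \<and> B \<in> abel_complexes R \<and> C \<in> abel_complexes R \<and>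
        (\<exists>f g. cofibration R A B f \<and> chain_isomorphism R (cokernel A B f) C g)}"

definition K0_subgroup :: "('a, 'z) ring_scheme \<Rightarrow> (('a, 'm) chain_complex \<Rightarrow>\<^sub>0 int) set" where
  "K0_subgroup R = generate (free_Abelian_group (abel_complexes R)) (K0_relations R)"

definition K0_abel :: "('a, 'z) ring_scheme \<Rightarrow> (('a, 'm) chain_complex \<Rightarrow>\<^sub>0 int) set monoid" where
  "K0_abel R = free_Abelian_group (abel_complexes R) Mod K0_subgroup R"

definition K0_class :: "('a, 'z) ring_scheme \<Rightarrow> ('a, 'm) chain_complex
    \<Rightarrow> (('a, 'm) chain_complex \<Rightarrow>\<^sub>0 int) set" where
  "K0_class R C = K0_subgroup R #>\<^bsub>free_Abelian_group (abel_complexes R)\<^esub> frag_of C"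

text \<open>The ring \<open>R\<close> as a module over itself, placed in the universe \<open>'m\<close> by transport of
  structure along a map \<open>e\<close> that is injective on \<open>carrier R\<close>.\<close>

definition regular_module :: "('a, 'z) ring_scheme \<Rightarrow> ('a \<Rightarrow> 'm) \<Rightarrow> ('a, 'm) module" where
  "regular_module R e = (let i = inv_into (carrier R) e in
     \<lparr>carrier = e ` carrier R,
      monoid.mult = (\<lambda>x y. e (i x \<otimes>\<^bsub>R\<^esub> i y)), monoid.one = e \<one>\<^bsub>R\<^esub>,
      ring.zero = e \<zero>\<^bsub>R\<^esub>, ring.add = (\<lambda>x y. e (i x \<oplus>\<^bsub>R\<^esub> i y)),
      module.smult = (\<lambda>r x. e (r \<otimes>\<^bsub>R\<^esub> i x))\<rparr>)"

definition Xi_ring :: "('a, 'z) ring_scheme \<Rightarrow> ('a \<Rightarrow> 'm) \<Rightarrow> ('a, 'm) chain_complex" where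
  "Xi_ring R e =
     \<lparr>chain_module = (\<lambda>n. if even n then regular_module R e
                         else (regular_module R e)\<lparr>carrier := {e \<zero>\<^bsub>R\<^esub>}\<rparr>),
      differential = (\<lambda>n x. e \<zero>\<^bsub>R\<^esub>)\<rparr>"

end

theory Submission
  imports Defs
begin

text \<open>The class of \<open>\<Xi> R\<close> has infinite order because an Euler characteristic detects it. For a complex
  \<open>C\<close> put \<open>\<chi>(C) = lim (1 - x) (\<Sum> (-1)\<^sup>n rank H\<^sub>n(C) x\<^sup>n)\<close> for \<open>x \<rightarrow> 1-\<close>. If \<open>\<chi>\<close> respects the two kinds of
  relations that define \<open>K\<^sub>0\<close>, then it extends to a homomorphism from \<open>K\<^sub>0\<close> to the real numbers. The homology of
  \<open>\<Xi> R\<close> has the ranks \<open>1, 0, 1, 0, \<dots>\<close>, so \<open>\<chi>(\<Xi> R) = lim (1 - x) / (1 - x\<^sup>2) = 1/2\<close>, and no nonzero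
  multiple of the class of \<open>\<Xi> R\<close> is zero.

  A quasi-isomorphism preserves the ranks of all homology modules, hence \<open>\<chi>\<close>. For a cofibration
  \<open>A \<rightarrow> B\<close> with cokernel \<open>C\<close>, let \<open>d\<^sub>n\<close> be the rank of the connecting homomorphism \<open>H\<^bsub>n+1\<^esub>(C) \<rightarrow> H\<^sub>n(A)\<close>.
  The long exact homology sequence gives
  \<open>rank H\<^sub>n(B) + d\<^sub>n + d\<^bsub>n-1\<^esub> = rank H\<^sub>n(A) + rank H\<^sub>n(C)\<close> (lemma \<open>homology_rank_relation\<close>). With signs, the
  terms \<open>d\<^sub>n + d\<^bsub>n-1\<^esub>\<close> telescope: their power series is \<open>(1 - x) (\<Sum> (-1)\<^sup>n d\<^sub>n x\<^sup>n)\<close>. Since \<open>d\<^sub>n\<close> is at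
  most the rank of \<open>H\<^sub>n(A)\<close>, controlled absolute growth of \<open>A\<close> shows that
  \<open>(1 - x)\<^sup>2 (\<Sum> (-1)\<^sup>n d\<^sub>n x\<^sup>n)\<close> tends to zero. Therefore \<open>\<chi>(B) = \<chi>(A) + \<chi>(C)\<close> (lemmas
  \<open>abel_limit_additive\<close> and \<open>abel_euler_characteristic_cofibration\<close>).

  Counting ranks along the long exact sequence requires that \<open>M \<mapsto> M \<otimes>\<^sub>R Q\<close> is exact. The tensor product is
  identified with the localization of \<open>M\<close> at the nonzero scalars (lemma \<open>tensor_iso_localization\<close>), whose
  elements are fractions \<open>x / s\<close>. Exactness is then visible on elements and, combined with rank-nullity over
  \<open>Q\<close>, gives lemma \<open>module_rank_exact\<close>.\<close>

section \<open>The field of quotients\<close>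

text \<open>Operations on classes of fractions are defined by a union over all representatives. Once the
  result is known not to depend on the representatives, the union collapses.\<close>

lemma UN_pairs_const:
  assumes "(x, s) \<in> S" "(y, t) \<in> T"
    and "\<And>a b c d. \<lbrakk>(a, b) \<in> S; (c, d) \<in> T\<rbrakk> \<Longrightarrow> f a b c d = k"
  shows "(\<Union>(a, b)\<in>S. \<Union>(c, d)\<in>T. f a b c d) = k"
proof -
  have "(\<Union>(c, d)\<in>T. f a b c d) = k" if "(a, b) \<in> S" for a b
    using assms(2,3) that by (intro SUP_eq_const) auto
  moreover have "S \<noteq> {}"
    using assms(1) by blast
  ultimately show ?thesis
    by (intro SUP_eq_const) (simp_all only: split_paired_all prod.case not_False_eq_True)
qed

context domain
begin

abbreviation denominators :: "'a set" where
  "denominators \<equiv> carrier R - {\<zero>}"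

lemma denominators_mult [simp]: "\<lbrakk>s \<in> denominators; t \<in> denominators\<rbrakk> \<Longrightarrow> s \<otimes> t \<in> denominators"
  by (auto simp: integral_iff)

lemma one_denominator [simp]: "\<one> \<in> denominators"
  by simp

lemma fraction_eq_iff:
  assumes "a \<in> carrier R" "b \<in> denominators" "c \<in> carrier R" "d \<in> denominators"
  shows "fraction R a b = fraction R c d \<longleftrightarrow> a \<otimes> d = c \<otimes> b"
proof
  assume "fraction R a b = fraction R c d"
  moreover have "(c, d) \<in> fraction R c d"
    using assms by (simp add: fraction_def)
  ultimately have "(c, d) \<in> fraction R a b"
    by simp
  then show "a \<otimes> d = c \<otimes> b"
    by (simp add: fraction_def)
next
  assume eq: "a \<otimes> d = c \<otimes> b"
  have "a \<otimes> y = x \<otimes> b \<longleftrightarrow> c \<otimes> y = x \<otimes> d" if "x \<in> carrier R" "y \<in> carrier R" for x y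
  proof -
    have "a \<otimes> y = x \<otimes> b \<longleftrightarrow> d \<otimes> (a \<otimes> y) = d \<otimes> (x \<otimes> b)"
      using assms that by (subst m_lcancel) auto
    also have "d \<otimes> (a \<otimes> y) = b \<otimes> (c \<otimes> y)"
      using assms that eq by (metis DiffD1 m_assoc m_comm)
    also have "d \<otimes> (x \<otimes> b) = b \<otimes> (x \<otimes> d)"
      using assms that by (simp add: m_ac)
    also have "b \<otimes> (c \<otimes> y) = b \<otimes> (x \<otimes> d) \<longleftrightarrow> c \<otimes> y = x \<otimes> d"
      using assms that by (subst m_lcancel) auto
    finally show ?thesis .
  qed
  then show "fraction R a b = fraction R c d"
    by (auto simp: fraction_def)
qed

text \<open>Expanding fractions is the tool for common denominators, and with a common denominator the
  field axioms reduce to the ring axioms for numerators.\<close>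

lemma fraction_expand:
  assumes "a \<in> carrier R" "b \<in> denominators" "c \<in> denominators"
  shows "fraction R (c \<otimes> a) (c \<otimes> b) = fraction R a b"
  using assms by (subst fraction_eq_iff) (auto simp: m_ac integral_iff)

lemma fraction_carrier [simp]:
  "\<lbrakk>a \<in> carrier R; b \<in> denominators\<rbrakk> \<Longrightarrow> fraction R a b \<in> carrier (quotient_field R)"
  by (auto simp: quotient_field_def)

lemma fractionE:
  assumes "q \<in> carrier (quotient_field R)"
  obtains a b where "a \<in> carrier R" "b \<in> denominators" "q = fraction R a b"
  using assms by (auto simp: quotient_field_def)

lemma fraction_mult:
  assumes "a \<in> carrier R" "b \<in> denominators" "c \<in> carrier R" "d \<in> denominators"
  shows "fraction R a b \<otimes>\<^bsub>quotient_field R\<^esub> fraction R c d = fraction R (a \<otimes> c) (b \<otimes> d)"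
proof -
  have key: "fraction R (x \<otimes> z) (y \<otimes> w) = fraction R (a \<otimes> c) (b \<otimes> d)"
    if xy: "(x, y) \<in> fraction R a b" and zw: "(z, w) \<in> fraction R c d" for x y z w
  proof -
    have C: "x \<in> carrier R" "y \<in> denominators" "a \<otimes> y = x \<otimes> b"
      "z \<in> carrier R" "w \<in> denominators" "c \<otimes> w = z \<otimes> d"
      using xy zw by (auto simp: fraction_def)
    have "x \<otimes> z \<otimes> (b \<otimes> d) = (x \<otimes> b) \<otimes> (z \<otimes> d)"
      using C(1,4) assms by (simp add: m_ac)
    also have "\<dots> = (a \<otimes> y) \<otimes> (c \<otimes> w)"
      using C by simp
    also have "\<dots> = a \<otimes> c \<otimes> (y \<otimes> w)"
      using C(2,5) assms by (simp add: m_ac)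
    finally show ?thesis
      using C assms by (subst fraction_eq_iff) (auto simp: integral_iff)
  qed
  have mem: "(a, b) \<in> fraction R a b" "(c, d) \<in> fraction R c d"
    using assms by (auto simp: fraction_def)
  show ?thesis
    by (simp add: quotient_field_def UN_pairs_const[OF mem key])
qed

lemma fraction_add:
  assumes "a \<in> carrier R" "b \<in> denominators" "c \<in> carrier R"
  shows "fraction R a b \<oplus>\<^bsub>quotient_field R\<^esub> fraction R c b = fraction R (a \<oplus> c) b"
proof -
  have key: "fraction R (x \<otimes> w \<oplus> z \<otimes> y) (y \<otimes> w) = fraction R (a \<oplus> c) b"
    if xy: "(x, y) \<in> fraction R a b" and zw: "(z, w) \<in> fraction R c b" for x y z w
  proof -
    have C: "x \<in> carrier R" "y \<in> denominators" "a \<otimes> y = x \<otimes> b"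
      "z \<in> carrier R" "w \<in> denominators" "c \<otimes> w = z \<otimes> b"
      using xy zw by (auto simp: fraction_def)
    have "(x \<otimes> w \<oplus> z \<otimes> y) \<otimes> b = (x \<otimes> b) \<otimes> w \<oplus> (z \<otimes> b) \<otimes> y"
      using C(1,2,4,5) assms by (simp add: m_ac l_distr r_distr)
    also have "\<dots> = (a \<otimes> y) \<otimes> w \<oplus> (c \<otimes> w) \<otimes> y"
      using C by simp
    also have "\<dots> = (a \<oplus> c) \<otimes> (y \<otimes> w)"
      using C(1,2,4,5) assms by (simp add: m_ac l_distr r_distr)
    finally show ?thesis
      using C assms by (subst fraction_eq_iff) (auto simp: integral_iff)
  qed
  have mem: "(a, b) \<in> fraction R a b" "(c, b) \<in> fraction R c b"
    using assms by (auto simp: fraction_def)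
  show ?thesis
    by (simp add: quotient_field_def UN_pairs_const[OF mem key])
qed

lemma common_denominator2:
  assumes "p \<in> carrier (quotient_field R)" "q \<in> carrier (quotient_field R)"
  obtains a b d where "a \<in> carrier R" "b \<in> carrier R" "d \<in> denominators"
    "p = fraction R a d" "q = fraction R b d"
proof -
  obtain a s b t where st: "a \<in> carrier R" "s \<in> denominators" "p = fraction R a s"
    "b \<in> carrier R" "t \<in> denominators" "q = fraction R b t"
    using assms by (elim fractionE) blast
  have "p = fraction R (t \<otimes> a) (t \<otimes> s)" "q = fraction R (s \<otimes> b) (t \<otimes> s)"
    using st fraction_expand[of a s t] fraction_expand[of b t s]
    by (simp_all add: m_comm[of s t])
  then show ?thesis
    using st(1,2,4,5) by (intro that[of "t \<otimes> a" "s \<otimes> b" "t \<otimes> s"]) (auto simp: integral_iff)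
qed

lemma quotient_field_zero: "\<zero>\<^bsub>quotient_field R\<^esub> = fraction R \<zero> \<one>"
  and quotient_field_one: "\<one>\<^bsub>quotient_field R\<^esub> = fraction R \<one> \<one>"
  by (simp_all add: quotient_field_def)

lemma fraction_zero: "b \<in> denominators \<Longrightarrow> fraction R \<zero> b = \<zero>\<^bsub>quotient_field R\<^esub>"
  unfolding quotient_field_zero by (subst fraction_eq_iff) auto

lemma common_denominator3:
  assumes "p \<in> carrier (quotient_field R)" "q \<in> carrier (quotient_field R)" "r \<in> carrier (quotient_field R)"
  obtains a b c d where "a \<in> carrier R" "b \<in> carrier R" "c \<in> carrier R" "d \<in> denominators"
    "p = fraction R a d" "q = fraction R b d" "r = fraction R c d"
proof -
  obtain a b s where s: "a \<in> carrier R" "b \<in> carrier R" "s \<in> denominators"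
      "p = fraction R a s" "q = fraction R b s"
    using assms(1,2) by (rule common_denominator2)
  obtain c t where t: "c \<in> carrier R" "t \<in> denominators" "r = fraction R c t"
    using assms(3) by (rule fractionE)
  have "p = fraction R (t \<otimes> a) (t \<otimes> s)" "q = fraction R (t \<otimes> b) (t \<otimes> s)" "r = fraction R (s \<otimes> c) (t \<otimes> s)"
    using s t fraction_expand[of a s t] fraction_expand[of b s t] fraction_expand[of c t s]
    by (simp_all add: m_comm[of s t])
  then show ?thesis
    using s(1-3) t(1,2)
    by (intro that[of "t \<otimes> a" "t \<otimes> b" "s \<otimes> c" "t \<otimes> s"]) (auto simp: integral_iff)
qed

lemma field_quotient_field: "field (quotient_field R)"
proof -
  let ?Q = "quotient_field R"
  have zero: "\<zero>\<^bsub>?Q\<^esub> \<in> carrier ?Q" and one: "\<one>\<^bsub>?Q\<^esub> \<in> carrier ?Q"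
    by (simp_all add: quotient_field_zero quotient_field_one)
  have grp: "abelian_group ?Q"
  proof (rule abelian_groupI)
    fix p q assume "p \<in> carrier ?Q" "q \<in> carrier ?Q"
    then obtain a b d where "a \<in> carrier R" "b \<in> carrier R" "d \<in> denominators"
      "p = fraction R a d" "q = fraction R b d"
      by (rule common_denominator2)
    then show "p \<oplus>\<^bsub>?Q\<^esub> q \<in> carrier ?Q" "p \<oplus>\<^bsub>?Q\<^esub> q = q \<oplus>\<^bsub>?Q\<^esub> p"
      by (simp_all add: fraction_add a_comm)
  next
    fix p q r assume "p \<in> carrier ?Q" "q \<in> carrier ?Q" "r \<in> carrier ?Q"
    then obtain a b c d where "a \<in> carrier R" "b \<in> carrier R" "c \<in> carrier R" "d \<in> denominators"
      "p = fraction R a d" "q = fraction R b d" "r = fraction R c d"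
      by (rule common_denominator3)
    then show "p \<oplus>\<^bsub>?Q\<^esub> q \<oplus>\<^bsub>?Q\<^esub> r = p \<oplus>\<^bsub>?Q\<^esub> (q \<oplus>\<^bsub>?Q\<^esub> r)"
      by (simp add: fraction_add a_assoc)
  next
    fix p assume "p \<in> carrier ?Q"
    then obtain a b where ab: "a \<in> carrier R" "b \<in> denominators" "p = fraction R a b"
      by (rule fractionE)
    then show "\<zero>\<^bsub>?Q\<^esub> \<oplus>\<^bsub>?Q\<^esub> p = p"
      by (simp add: fraction_add flip: fraction_zero[of b])
    show "\<exists>q\<in>carrier ?Q. q \<oplus>\<^bsub>?Q\<^esub> p = \<zero>\<^bsub>?Q\<^esub>"
      using ab by (intro bexI[of _ "fraction R (\<ominus> a) b"]) (simp_all add: fraction_add fraction_zero l_neg)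
  qed (rule zero)
  have mon: "comm_monoid ?Q"
  proof (rule comm_monoidI)
    fix p q assume "p \<in> carrier ?Q" "q \<in> carrier ?Q"
    then obtain a b d where "a \<in> carrier R" "b \<in> carrier R" "d \<in> denominators"
      "p = fraction R a d" "q = fraction R b d"
      by (rule common_denominator2)
    then show "p \<otimes>\<^bsub>?Q\<^esub> q \<in> carrier ?Q" "p \<otimes>\<^bsub>?Q\<^esub> q = q \<otimes>\<^bsub>?Q\<^esub> p"
      by (simp_all add: fraction_mult m_comm integral_iff)
  next
    fix p q r assume "p \<in> carrier ?Q" "q \<in> carrier ?Q" "r \<in> carrier ?Q"
    then obtain a b c d where "a \<in> carrier R" "b \<in> carrier R" "c \<in> carrier R" "d \<in> denominators"
      "p = fraction R a d" "q = fraction R b d" "r = fraction R c d"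
      by (rule common_denominator3)
    then show "p \<otimes>\<^bsub>?Q\<^esub> q \<otimes>\<^bsub>?Q\<^esub> r = p \<otimes>\<^bsub>?Q\<^esub> (q \<otimes>\<^bsub>?Q\<^esub> r)"
      by (simp add: fraction_mult m_assoc integral_iff)
  next
    fix p assume "p \<in> carrier ?Q"
    then obtain a b where ab: "a \<in> carrier R" "b \<in> denominators" "p = fraction R a b"
      by (rule fractionE)
    then show "\<one>\<^bsub>?Q\<^esub> \<otimes>\<^bsub>?Q\<^esub> p = p"
      by (simp add: fraction_mult quotient_field_one)
  qed (rule one)
  have "cring ?Q"
  proof (rule cringI[OF grp mon])
    fix p q r assume "p \<in> carrier ?Q" "q \<in> carrier ?Q" "r \<in> carrier ?Q"
    then obtain a b c d where "a \<in> carrier R" "b \<in> carrier R" "c \<in> carrier R" "d \<in> denominators"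
      "p = fraction R a d" "q = fraction R b d" "r = fraction R c d"
      by (rule common_denominator3)
    then show "(p \<oplus>\<^bsub>?Q\<^esub> q) \<otimes>\<^bsub>?Q\<^esub> r = p \<otimes>\<^bsub>?Q\<^esub> r \<oplus>\<^bsub>?Q\<^esub> q \<otimes>\<^bsub>?Q\<^esub> r"
      by (simp add: fraction_add fraction_mult l_distr integral_iff)
  qed
  then interpret Q: cring ?Q .
  have inverse: "p \<in> Units ?Q" if p: "p \<in> carrier ?Q" and nz: "p \<noteq> \<zero>\<^bsub>?Q\<^esub>" for p
  proof -
    obtain a b where ab: "a \<in> carrier R" "b \<in> denominators" "p = fraction R a b"
      using p by (rule fractionE)
    with nz have a: "a \<in> denominators"
      using fraction_zero by fastforce
    have "fraction R b a \<otimes>\<^bsub>?Q\<^esub> p = \<one>\<^bsub>?Q\<^esub>"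
      using ab a unfolding quotient_field_one
      by (simp add: fraction_mult fraction_eq_iff integral_iff m_comm)
    then show ?thesis
      using ab a p Q.m_comm[of "fraction R b a" p] unfolding Units_def
      by (auto intro!: bexI[of _ "fraction R b a"])
  qed
  have "\<zero>\<^bsub>?Q\<^esub> \<noteq> \<one>\<^bsub>?Q\<^esub>"
    unfolding quotient_field_zero quotient_field_one by (subst fraction_eq_iff) auto
  then have "\<zero>\<^bsub>?Q\<^esub> \<notin> Units ?Q"
    by (metis Q.Units_closed Q.Units_l_inv_ex Q.r_null)
  then have "Units ?Q = carrier ?Q - {\<zero>\<^bsub>?Q\<^esub>}"
    using inverse Q.Units_closed by auto
  then show ?thesis
    by (rule Q.cring_fieldI)
qed

end

section \<open>Localization of a module at the nonzero scalars\<close>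

text \<open>The fraction \<open>x / s\<close> as an equivalence class of pairs. The factor \<open>u\<close> is needed because \<open>M\<close>
  may have torsion.\<close>

definition mfrac :: "('a, 'z) ring_scheme \<Rightarrow> ('a, 'm, 'e) module_scheme \<Rightarrow> 'm \<Rightarrow> 'a \<Rightarrow> ('m \<times> 'a) set" where
  "mfrac R M x s = {(y, t). y \<in> carrier M \<and> t \<in> carrier R - {\<zero>\<^bsub>R\<^esub>} \<and>
     (\<exists>u\<in>carrier R - {\<zero>\<^bsub>R\<^esub>}. (u \<otimes>\<^bsub>R\<^esub> t) \<odot>\<^bsub>M\<^esub> x = (u \<otimes>\<^bsub>R\<^esub> s) \<odot>\<^bsub>M\<^esub> y)}"

text \<open>A concrete model of \<open>M \<otimes>\<^sub>R Q\<close>. Its elements are fractions, and a fraction vanishes exactly if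
  its numerator is torsion, so that exactness can be checked on elements.\<close>

definition localization :: "('a, 'z) ring_scheme \<Rightarrow> ('a, 'm, 'e) module_scheme
    \<Rightarrow> (('a \<times> 'a) set, ('m \<times> 'a) set) module" where
  "localization R M =
     \<lparr>carrier = {mfrac R M x s | x s. x \<in> carrier M \<and> s \<in> carrier R - {\<zero>\<^bsub>R\<^esub>}},
      monoid.mult = (\<lambda>_ _. mfrac R M \<zero>\<^bsub>M\<^esub> \<one>\<^bsub>R\<^esub>), monoid.one = mfrac R M \<zero>\<^bsub>M\<^esub> \<one>\<^bsub>R\<^esub>,
      ring.zero = mfrac R M \<zero>\<^bsub>M\<^esub> \<one>\<^bsub>R\<^esub>,
      ring.add = (\<lambda>S T. \<Union>(x, s)\<in>S. \<Union>(y, t)\<in>T.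
        mfrac R M ((t \<odot>\<^bsub>M\<^esub> x) \<oplus>\<^bsub>M\<^esub> (s \<odot>\<^bsub>M\<^esub> y)) (s \<otimes>\<^bsub>R\<^esub> t)),
      module.smult = (\<lambda>q S. \<Union>(a, b)\<in>q. \<Union>(x, s)\<in>S. mfrac R M (a \<odot>\<^bsub>M\<^esub> x) (b \<otimes>\<^bsub>R\<^esub> s))\<rparr>"

locale module_over_domain = R?: domain R + Module.module R M for R (structure) and M (structure)
begin

lemma smult_smult_left:
  "\<lbrakk>a \<in> carrier R; b \<in> carrier R; x \<in> carrier M\<rbrakk> \<Longrightarrow> a \<odot>\<^bsub>M\<^esub> (b \<odot>\<^bsub>M\<^esub> x) = (a \<otimes> b) \<odot>\<^bsub>M\<^esub> x"
  by (simp add: smult_assoc1)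

lemma mfrac_eq_iff:
  assumes "x \<in> carrier M" "s \<in> denominators" "y \<in> carrier M" "t \<in> denominators"
  shows "mfrac R M x s = mfrac R M y t \<longleftrightarrow> (\<exists>u\<in>denominators. (u \<otimes> t) \<odot>\<^bsub>M\<^esub> x = (u \<otimes> s) \<odot>\<^bsub>M\<^esub> y)"
proof
  assume "mfrac R M x s = mfrac R M y t"
  moreover have "(y, t) \<in> mfrac R M y t"
    using assms one_denominator by (auto simp: mfrac_def)
  ultimately have "(y, t) \<in> mfrac R M x s"
    by simp
  then show "\<exists>u\<in>denominators. (u \<otimes> t) \<odot>\<^bsub>M\<^esub> x = (u \<otimes> s) \<odot>\<^bsub>M\<^esub> y"
    by (simp add: mfrac_def)
next
  have subset: "mfrac R M x s \<subseteq> mfrac R M y t"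
    if "x \<in> carrier M" "s \<in> denominators" "y \<in> carrier M" "t \<in> denominators"
       "u \<in> denominators" and u: "(u \<otimes> t) \<odot>\<^bsub>M\<^esub> x = (u \<otimes> s) \<odot>\<^bsub>M\<^esub> y" for x s y t u
  proof clarify
    fix z r assume "(z, r) \<in> mfrac R M x s"
    then obtain v where z: "z \<in> carrier M" "r \<in> denominators" "v \<in> denominators"
      and v: "(v \<otimes> r) \<odot>\<^bsub>M\<^esub> x = (v \<otimes> s) \<odot>\<^bsub>M\<^esub> z"
      by (auto simp: mfrac_def)
    have "(u \<otimes> v \<otimes> s \<otimes> r) \<odot>\<^bsub>M\<^esub> y = (v \<otimes> r) \<odot>\<^bsub>M\<^esub> ((u \<otimes> s) \<odot>\<^bsub>M\<^esub> y)"
      using that(1-5) z by (simp add: smult_smult_left m_ac)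
    also have "\<dots> = (v \<otimes> r) \<odot>\<^bsub>M\<^esub> ((u \<otimes> t) \<odot>\<^bsub>M\<^esub> x)"
      using u by simp
    also have "\<dots> = (u \<otimes> t) \<odot>\<^bsub>M\<^esub> ((v \<otimes> r) \<odot>\<^bsub>M\<^esub> x)"
      using that(1-5) z by (simp add: smult_smult_left m_ac)
    also have "\<dots> = (u \<otimes> t) \<odot>\<^bsub>M\<^esub> ((v \<otimes> s) \<odot>\<^bsub>M\<^esub> z)"
      using v by simp
    also have "\<dots> = (u \<otimes> v \<otimes> s \<otimes> t) \<odot>\<^bsub>M\<^esub> z"
      using that(1-5) z by (simp add: smult_smult_left m_ac)
    finally show "(z, r) \<in> mfrac R M y t"
      using that(1-5) z unfolding mfrac_def
      by (auto intro!: bexI[of _ "u \<otimes> v \<otimes> s"] simp: integral_iff)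
  qed
  assume "\<exists>u\<in>denominators. (u \<otimes> t) \<odot>\<^bsub>M\<^esub> x = (u \<otimes> s) \<odot>\<^bsub>M\<^esub> y"
  then obtain u where "u \<in> denominators" "(u \<otimes> t) \<odot>\<^bsub>M\<^esub> x = (u \<otimes> s) \<odot>\<^bsub>M\<^esub> y"
    by blast
  then show "mfrac R M x s = mfrac R M y t"
    using subset[of x s y t u] subset[of y t x s u] assms by auto
qed

lemma mfrac_eq_same_denominator_iff:
  assumes "x \<in> carrier M" "y \<in> carrier M" "s \<in> denominators"
  shows "mfrac R M x s = mfrac R M y s \<longleftrightarrow> (\<exists>u\<in>denominators. u \<odot>\<^bsub>M\<^esub> x = u \<odot>\<^bsub>M\<^esub> y)"
proof -
  have "(\<exists>u\<in>denominators. (u \<otimes> s) \<odot>\<^bsub>M\<^esub> x = (u \<otimes> s) \<odot>\<^bsub>M\<^esub> y) \<longleftrightarrow> (\<exists>u\<in>denominators. u \<odot>\<^bsub>M\<^esub> x = u \<odot>\<^bsub>M\<^esub> y)"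
  proof (intro iffI; elim bexE)
    fix u assume u: "u \<in> denominators" and eq: "u \<odot>\<^bsub>M\<^esub> x = u \<odot>\<^bsub>M\<^esub> y"
    have "(s \<otimes> u) \<odot>\<^bsub>M\<^esub> x = (s \<otimes> u) \<odot>\<^bsub>M\<^esub> y"
      using u assms eq by (simp add: smult_assoc1)
    then show "\<exists>u\<in>denominators. (u \<otimes> s) \<odot>\<^bsub>M\<^esub> x = (u \<otimes> s) \<odot>\<^bsub>M\<^esub> y"
      using u assms by (intro bexI[of _ u]) (simp_all add: m_comm)
  qed (use assms denominators_mult in blast)
  then show ?thesis
    using assms by (simp add: mfrac_eq_iff)
qed

lemma mfrac_expand:
  assumes "x \<in> carrier M" "s \<in> denominators" "c \<in> denominators"
  shows "mfrac R M (c \<odot>\<^bsub>M\<^esub> x) (c \<otimes> s) = mfrac R M x s"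
  using assms by (subst mfrac_eq_iff) (auto intro!: bexI[of _ \<one>] simp: smult_smult_left m_ac integral_iff)

lemma mfrac_carrier [simp]:
  "\<lbrakk>x \<in> carrier M; s \<in> denominators\<rbrakk> \<Longrightarrow> mfrac R M x s \<in> carrier (localization R M)"
  by (auto simp: localization_def)

lemma mfracE:
  assumes "v \<in> carrier (localization R M)"
  obtains x s where "x \<in> carrier M" "s \<in> denominators" "v = mfrac R M x s"
  using assms by (auto simp: localization_def)

lemma mfrac_add:
  assumes "x \<in> carrier M" "y \<in> carrier M" "s \<in> denominators"
  shows "mfrac R M x s \<oplus>\<^bsub>localization R M\<^esub> mfrac R M y s = mfrac R M (x \<oplus>\<^bsub>M\<^esub> y) s"
proof -
  have key: "mfrac R M ((r \<odot>\<^bsub>M\<^esub> a) \<oplus>\<^bsub>M\<^esub> (t \<odot>\<^bsub>M\<^esub> b)) (t \<otimes> r) = mfrac R M (x \<oplus>\<^bsub>M\<^esub> y) s"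
    if a: "(a, t) \<in> mfrac R M x s" and b: "(b, r) \<in> mfrac R M y s" for a t b r
  proof -
    obtain u v where C: "a \<in> carrier M" "t \<in> denominators" "u \<in> denominators"
        "b \<in> carrier M" "r \<in> denominators" "v \<in> denominators"
      and u: "(u \<otimes> t) \<odot>\<^bsub>M\<^esub> x = (u \<otimes> s) \<odot>\<^bsub>M\<^esub> a" and v: "(v \<otimes> r) \<odot>\<^bsub>M\<^esub> y = (v \<otimes> s) \<odot>\<^bsub>M\<^esub> b"
      using a b by (auto simp: mfrac_def)
    have "(u \<otimes> v \<otimes> s) \<odot>\<^bsub>M\<^esub> ((r \<odot>\<^bsub>M\<^esub> a) \<oplus>\<^bsub>M\<^esub> (t \<odot>\<^bsub>M\<^esub> b))
        = (v \<otimes> r) \<odot>\<^bsub>M\<^esub> ((u \<otimes> s) \<odot>\<^bsub>M\<^esub> a) \<oplus>\<^bsub>M\<^esub> (u \<otimes> t) \<odot>\<^bsub>M\<^esub> ((v \<otimes> s) \<odot>\<^bsub>M\<^esub> b)"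
      using C assms by (simp add: smult_smult_left m_ac smult_r_distr)
    also have "\<dots> = (v \<otimes> r) \<odot>\<^bsub>M\<^esub> ((u \<otimes> t) \<odot>\<^bsub>M\<^esub> x) \<oplus>\<^bsub>M\<^esub> (u \<otimes> t) \<odot>\<^bsub>M\<^esub> ((v \<otimes> r) \<odot>\<^bsub>M\<^esub> y)"
      using u v by simp
    also have "\<dots> = (u \<otimes> v \<otimes> (t \<otimes> r)) \<odot>\<^bsub>M\<^esub> (x \<oplus>\<^bsub>M\<^esub> y)"
      using C assms by (simp add: smult_smult_left m_ac smult_r_distr)
    finally show ?thesis
      using C assms by (subst mfrac_eq_iff) (auto intro!: bexI[of _ "u \<otimes> v"] simp: integral_iff)
  qed
  have mem: "(x, s) \<in> mfrac R M x s" "(y, s) \<in> mfrac R M y s"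
    using assms one_denominator by (auto simp: mfrac_def)
  show ?thesis
    by (simp add: localization_def UN_pairs_const[OF mem key])
qed

lemma mfrac_smult:
  assumes "a \<in> carrier R" "b \<in> denominators" "x \<in> carrier M" "s \<in> denominators"
  shows "fraction R a b \<odot>\<^bsub>localization R M\<^esub> mfrac R M x s = mfrac R M (a \<odot>\<^bsub>M\<^esub> x) (b \<otimes> s)"
proof -
  have key: "mfrac R M (c \<odot>\<^bsub>M\<^esub> y) (d \<otimes> t) = mfrac R M (a \<odot>\<^bsub>M\<^esub> x) (b \<otimes> s)"
    if c: "(c, d) \<in> fraction R a b" and y: "(y, t) \<in> mfrac R M x s" for c d y t
  proof -
    have cd: "c \<in> carrier R" "d \<in> denominators" and eq: "a \<otimes> d = c \<otimes> b"
      using c by (auto simp: fraction_def)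
    obtain u where C: "y \<in> carrier M" "t \<in> denominators" "u \<in> denominators"
      and u: "(u \<otimes> t) \<odot>\<^bsub>M\<^esub> x = (u \<otimes> s) \<odot>\<^bsub>M\<^esub> y"
      using y by (auto simp: mfrac_def)
    have "(u \<otimes> (b \<otimes> s)) \<odot>\<^bsub>M\<^esub> (c \<odot>\<^bsub>M\<^esub> y) = (c \<otimes> b) \<odot>\<^bsub>M\<^esub> ((u \<otimes> s) \<odot>\<^bsub>M\<^esub> y)"
      using C cd assms by (simp add: smult_smult_left m_ac)
    also have "\<dots> = (a \<otimes> d) \<odot>\<^bsub>M\<^esub> ((u \<otimes> t) \<odot>\<^bsub>M\<^esub> x)"
      using u eq by simp
    also have "\<dots> = (u \<otimes> (d \<otimes> t)) \<odot>\<^bsub>M\<^esub> (a \<odot>\<^bsub>M\<^esub> x)"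
      using C cd assms by (simp add: smult_smult_left m_ac)
    finally show ?thesis
      using C cd assms by (subst mfrac_eq_iff) (auto intro!: bexI[of _ u] simp: integral_iff)
  qed
  have mem: "(a, b) \<in> fraction R a b" "(x, s) \<in> mfrac R M x s"
    using assms one_denominator by (auto simp: fraction_def mfrac_def)
  show ?thesis
    by (simp add: localization_def UN_pairs_const[OF mem key])
qed

lemma localization_zero: "\<zero>\<^bsub>localization R M\<^esub> = mfrac R M \<zero>\<^bsub>M\<^esub> \<one>"
  by (simp add: localization_def)

lemma mfrac_zero: "s \<in> denominators \<Longrightarrow> mfrac R M \<zero>\<^bsub>M\<^esub> s = \<zero>\<^bsub>localization R M\<^esub>"
  unfolding localization_zero by (subst mfrac_eq_iff) (auto intro!: bexI[of _ \<one>])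

lemma mfrac_eq_zero_iff:
  assumes "x \<in> carrier M" "s \<in> denominators"
  shows "mfrac R M x s = \<zero>\<^bsub>localization R M\<^esub> \<longleftrightarrow> (\<exists>u\<in>denominators. u \<odot>\<^bsub>M\<^esub> x = \<zero>\<^bsub>M\<^esub>)"
  using assms mfrac_eq_same_denominator_iff[of x "\<zero>\<^bsub>M\<^esub>" s] by (auto simp: mfrac_zero)

lemma mfrac_common_denominator2:
  assumes "v \<in> carrier (localization R M)" "w \<in> carrier (localization R M)"
  obtains x y s where "x \<in> carrier M" "y \<in> carrier M" "s \<in> denominators"
    "v = mfrac R M x s" "w = mfrac R M y s"
proof -
  obtain x s y t where st: "x \<in> carrier M" "s \<in> denominators" "v = mfrac R M x s"
    "y \<in> carrier M" "t \<in> denominators" "w = mfrac R M y t"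
    using assms by (elim mfracE) blast
  have "v = mfrac R M (t \<odot>\<^bsub>M\<^esub> x) (t \<otimes> s)" "w = mfrac R M (s \<odot>\<^bsub>M\<^esub> y) (t \<otimes> s)"
    using st mfrac_expand[of x s t] mfrac_expand[of y t s]
    by (simp_all add: m_comm[of s t])
  then show ?thesis
    using st(1,2,4,5) by (intro that[of "t \<odot>\<^bsub>M\<^esub> x" "s \<odot>\<^bsub>M\<^esub> y" "t \<otimes> s"]) (auto simp: integral_iff)
qed

lemma mfrac_common_denominator3:
  assumes "u \<in> carrier (localization R M)" "v \<in> carrier (localization R M)" "w \<in> carrier (localization R M)"
  obtains x y z s where "x \<in> carrier M" "y \<in> carrier M" "z \<in> carrier M" "s \<in> denominators"
    "u = mfrac R M x s" "v = mfrac R M y s" "w = mfrac R M z s"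
proof -
  obtain x y s where s: "x \<in> carrier M" "y \<in> carrier M" "s \<in> denominators"
      "u = mfrac R M x s" "v = mfrac R M y s"
    using assms(1,2) by (rule mfrac_common_denominator2)
  obtain z t where t: "z \<in> carrier M" "t \<in> denominators" "w = mfrac R M z t"
    using assms(3) by (rule mfracE)
  have "u = mfrac R M (t \<odot>\<^bsub>M\<^esub> x) (t \<otimes> s)" "v = mfrac R M (t \<odot>\<^bsub>M\<^esub> y) (t \<otimes> s)"
      "w = mfrac R M (s \<odot>\<^bsub>M\<^esub> z) (t \<otimes> s)"
    using s t mfrac_expand[of x s t] mfrac_expand[of y s t] mfrac_expand[of z t s]
    by (simp_all add: m_comm[of s t])
  then show ?thesis
    using s(1-3) t(1,2)
    by (intro that[of "t \<odot>\<^bsub>M\<^esub> x" "t \<odot>\<^bsub>M\<^esub> y" "s \<odot>\<^bsub>M\<^esub> z" "t \<otimes> s"]) (auto simp: integral_iff)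
qed

text \<open>Any three fractions have a common denominator, which turns each axiom into the corresponding
  one for numerators in \<open>M\<close>.\<close>

lemma vectorspace_localization: "vectorspace (quotient_field R) (localization R M)"
proof -
  let ?Q = "quotient_field R" and ?L = "localization R M"
  interpret Q: field ?Q
    by (rule field_quotient_field)
  have grp: "abelian_group ?L"
  proof (rule abelian_groupI)
    fix v w assume "v \<in> carrier ?L" "w \<in> carrier ?L"
    then obtain x y s where "x \<in> carrier M" "y \<in> carrier M" "s \<in> denominators"
      "v = mfrac R M x s" "w = mfrac R M y s"
      by (rule mfrac_common_denominator2)
    then show "v \<oplus>\<^bsub>?L\<^esub> w \<in> carrier ?L" "v \<oplus>\<^bsub>?L\<^esub> w = w \<oplus>\<^bsub>?L\<^esub> v"
      by (simp_all add: mfrac_add M.a_comm)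
  next
    fix u v w assume "u \<in> carrier ?L" "v \<in> carrier ?L" "w \<in> carrier ?L"
    then obtain x y z s where "x \<in> carrier M" "y \<in> carrier M" "z \<in> carrier M" "s \<in> denominators"
      "u = mfrac R M x s" "v = mfrac R M y s" "w = mfrac R M z s"
      by (rule mfrac_common_denominator3)
    then show "u \<oplus>\<^bsub>?L\<^esub> v \<oplus>\<^bsub>?L\<^esub> w = u \<oplus>\<^bsub>?L\<^esub> (v \<oplus>\<^bsub>?L\<^esub> w)"
      by (simp add: mfrac_add M.a_assoc)
  next
    fix v assume "v \<in> carrier ?L"
    then obtain x s where xs: "x \<in> carrier M" "s \<in> denominators" "v = mfrac R M x s"
      by (rule mfracE)
    then show "\<zero>\<^bsub>?L\<^esub> \<oplus>\<^bsub>?L\<^esub> v = v"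
      by (simp add: mfrac_add flip: mfrac_zero[of s])
    show "\<exists>w\<in>carrier ?L. w \<oplus>\<^bsub>?L\<^esub> v = \<zero>\<^bsub>?L\<^esub>"
      using xs by (intro bexI[of _ "mfrac R M (\<ominus>\<^bsub>M\<^esub> x) s"]) (simp_all add: mfrac_add mfrac_zero M.l_neg)
  qed (simp add: localization_zero)
  have "Module.module ?Q ?L"
  proof (rule moduleI[OF Q.cring_axioms grp])
    fix p v assume "p \<in> carrier ?Q" "v \<in> carrier ?L"
    then show "p \<odot>\<^bsub>?L\<^esub> v \<in> carrier ?L"
      by (elim fractionE mfracE) (simp add: mfrac_smult integral_iff)
  next
    fix p q v assume pq: "p \<in> carrier ?Q" "q \<in> carrier ?Q" and v: "v \<in> carrier ?L"
    obtain a b d where "a \<in> carrier R" "b \<in> carrier R" "d \<in> denominators"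
      "p = fraction R a d" "q = fraction R b d"
      using pq by (rule common_denominator2)
    moreover obtain x s where "x \<in> carrier M" "s \<in> denominators" "v = mfrac R M x s"
      using v by (rule mfracE)
    ultimately show "(p \<oplus>\<^bsub>?Q\<^esub> q) \<odot>\<^bsub>?L\<^esub> v = p \<odot>\<^bsub>?L\<^esub> v \<oplus>\<^bsub>?L\<^esub> q \<odot>\<^bsub>?L\<^esub> v"
        "(p \<otimes>\<^bsub>?Q\<^esub> q) \<odot>\<^bsub>?L\<^esub> v = p \<odot>\<^bsub>?L\<^esub> (q \<odot>\<^bsub>?L\<^esub> v)"
      by (simp_all add: fraction_add fraction_mult mfrac_smult mfrac_add smult_l_distr smult_assoc1
          integral_iff m_assoc)
  next
    fix p v w assume p: "p \<in> carrier ?Q" and vw: "v \<in> carrier ?L" "w \<in> carrier ?L"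
    obtain x y s where "x \<in> carrier M" "y \<in> carrier M" "s \<in> denominators"
      "v = mfrac R M x s" "w = mfrac R M y s"
      using vw by (rule mfrac_common_denominator2)
    moreover obtain a b where "a \<in> carrier R" "b \<in> denominators" "p = fraction R a b"
      using p by (rule fractionE)
    ultimately show "p \<odot>\<^bsub>?L\<^esub> (v \<oplus>\<^bsub>?L\<^esub> w) = p \<odot>\<^bsub>?L\<^esub> v \<oplus>\<^bsub>?L\<^esub> p \<odot>\<^bsub>?L\<^esub> w"
      by (simp add: mfrac_smult mfrac_add smult_r_distr integral_iff)
  next
    fix v assume "v \<in> carrier ?L"
    then show "\<one>\<^bsub>?Q\<^esub> \<odot>\<^bsub>?L\<^esub> v = v"
      unfolding quotient_field_one by (elim mfracE) (simp add: mfrac_smult)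
  qed
  then show ?thesis
    by (intro vectorspace.intro Q.field_axioms)
qed

end

section \<open>Quotient modules\<close>

text \<open>On the free group behind the tensor product, scalars act by additive maps that preserve the
  relations, and the module laws hold only in the quotient. Submodules of modules are instances as
  well, so one analysis of cosets serves for tensor products, homology and cokernels.\<close>

locale stable_subgroup = abelian_group M + additive_subgroup N M
  for R :: "('a, 'z) ring_scheme" and M :: "('a, 'm, 'e) module_scheme" (structure) and N +
  assumes scalar_closed: "\<lbrakk>a \<in> carrier R; x \<in> carrier M\<rbrakk> \<Longrightarrow> a \<odot> x \<in> carrier M"
    and scalar_add: "\<lbrakk>a \<in> carrier R; x \<in> carrier M; y \<in> carrier M\<rbrakk> \<Longrightarrow> a \<odot> (x \<oplus> y) = a \<odot> x \<oplus> a \<odot> y"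
    and scalar_stable: "\<lbrakk>a \<in> carrier R; x \<in> N\<rbrakk> \<Longrightarrow> a \<odot> x \<in> N"
begin

lemma abelian_subgroup: "abelian_subgroup N M"
  by (rule abelian_subgroupI3) (rule additive_subgroup_axioms abelian_group_axioms)+

lemma coset_eq_iff:
  assumes "x \<in> carrier M" "y \<in> carrier M"
  shows "N +> x = N +> y \<longleftrightarrow> x \<ominus> y \<in> N"
proof -
  interpret abelian_subgroup N M by (rule abelian_subgroup)
  have "N +> x = N +> y \<longleftrightarrow> x \<in> N +> y"
    using assms a_repr_independence' a_rcos_self by metis
  then show ?thesis
    using assms a_rcos_module by (simp add: a_minus_def)
qed

lemma quotient_module_carrier: "carrier (quotient_module M N) = (\<lambda>x. N +> x) ` carrier M"
  by (auto simp: quotient_module_def A_RCOSETS_def')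

lemma quotient_module_add:
  "\<lbrakk>x \<in> carrier M; y \<in> carrier M\<rbrakk> \<Longrightarrow> (N +> x) \<oplus>\<^bsub>quotient_module M N\<^esub> (N +> y) = N +> (x \<oplus> y)"
  using abelian_subgroup.a_rcos_sum[OF abelian_subgroup] by (simp add: quotient_module_def)

lemma quotient_module_zero: "\<zero>\<^bsub>quotient_module M N\<^esub> = N +> \<zero>"
  using a_subset by (simp add: quotient_module_def)

lemma quotient_module_smult:
  assumes "a \<in> carrier R" "x \<in> carrier M"
  shows "a \<odot>\<^bsub>quotient_module M N\<^esub> (N +> x) = N +> (a \<odot> x)"
proof -
  interpret abelian_subgroup N M by (rule abelian_subgroup)
  have "(\<Union>z\<in>N +> x. N +> (a \<odot> z)) = N +> (a \<odot> x)"
  proof (rule SUP_eq_const)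
    show "N +> x \<noteq> {}"
      using a_rcos_self assms(2) by blast
  next
    fix z assume "z \<in> N +> x"
    then obtain n where n: "n \<in> N" "z = n \<oplus> x"
      by (auto simp: a_r_coset_def')
    then have "a \<odot> z = a \<odot> n \<oplus> a \<odot> x"
      using assms a_subset by (auto simp: scalar_add)
    then have "a \<odot> z \<in> N +> (a \<odot> x)"
      using scalar_stable[OF assms(1) n(1)] by (auto simp: a_r_coset_def')
    then show "N +> (a \<odot> z) = N +> (a \<odot> x)"
      using a_repr_independence'[of "a \<odot> z" "a \<odot> x"] scalar_closed[OF assms] by simp
  qed
  then show ?thesis
    by (simp add: quotient_module_def)
qed

lemma abelian_group_quotient_module: "abelian_group (quotient_module M N)"
proof (rule abelian_groupI)
  let ?Q = "quotient_module M N"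
  fix S T U assume "S \<in> carrier ?Q" "T \<in> carrier ?Q" "U \<in> carrier ?Q"
  then show "S \<oplus>\<^bsub>?Q\<^esub> T \<oplus>\<^bsub>?Q\<^esub> U = S \<oplus>\<^bsub>?Q\<^esub> (T \<oplus>\<^bsub>?Q\<^esub> U)"
    by (auto simp: quotient_module_carrier quotient_module_add a_assoc)
next
  let ?Q = "quotient_module M N"
  fix S T assume "S \<in> carrier ?Q" "T \<in> carrier ?Q"
  then show "S \<oplus>\<^bsub>?Q\<^esub> T \<in> carrier ?Q" "S \<oplus>\<^bsub>?Q\<^esub> T = T \<oplus>\<^bsub>?Q\<^esub> S"
    by (auto simp: quotient_module_carrier quotient_module_add a_comm)
next
  let ?Q = "quotient_module M N"
  show "\<zero>\<^bsub>?Q\<^esub> \<in> carrier ?Q"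
    by (simp add: quotient_module_carrier quotient_module_zero)
  fix S assume "S \<in> carrier ?Q"
  then obtain x where x: "x \<in> carrier M" "S = N +> x"
    by (auto simp: quotient_module_carrier)
  then show "\<zero>\<^bsub>?Q\<^esub> \<oplus>\<^bsub>?Q\<^esub> S = S"
    unfolding quotient_module_zero by (simp add: quotient_module_add)
  show "\<exists>T\<in>carrier ?Q. T \<oplus>\<^bsub>?Q\<^esub> S = \<zero>\<^bsub>?Q\<^esub>"
    unfolding quotient_module_zero using x
    by (intro bexI[of _ "N +> (\<ominus> x)"]) (simp_all add: quotient_module_add quotient_module_carrier l_neg)
qed

end

lemma stable_subgroup_submodule:
  assumes "Module.module R M" "LinearCombinations.submodule R N M"
  shows "stable_subgroup R M N"
proof -
  interpret M: Module.module R M by fact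
  interpret N: LinearCombinations.submodule R N M by fact
  have "\<ominus>\<^bsub>M\<^esub> x \<in> N" if "x \<in> N" for x
  proof -
    have "\<ominus>\<^bsub>R\<^esub> \<one>\<^bsub>R\<^esub> \<odot>\<^bsub>M\<^esub> x \<in> N"
      using that by (intro N.smult_closed) simp_all
    moreover have "\<ominus>\<^bsub>R\<^esub> \<one>\<^bsub>R\<^esub> \<odot>\<^bsub>M\<^esub> x = \<ominus>\<^bsub>M\<^esub> x"
      using that N.subset by (intro M.smult_minus_1) auto
    ultimately show ?thesis
      by (simp only:)
  qed
  then have "additive_subgroup N M"
    using N.subset by (intro additive_subgroup.intro subgroup.intro) (auto simp flip: a_inv_def)
  then show ?thesis
    by (intro stable_subgroup.intro M.abelian_group_axioms stable_subgroup_axioms.intro)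
      (auto simp: M.smult_r_distr)
qed

lemma module_quotient_module:
  assumes "Module.module R M" "LinearCombinations.submodule R N M"
  shows "Module.module R (quotient_module M N)"
proof -
  interpret M: Module.module R M by fact
  interpret N: stable_subgroup R M N
    using assms by (rule stable_subgroup_submodule)
  show ?thesis
    by (rule Module.moduleI[OF M.R.cring_axioms N.abelian_group_quotient_module])
      (auto simp: N.quotient_module_carrier N.quotient_module_smult N.quotient_module_add
        M.smult_l_distr M.smult_r_distr M.smult_assoc1)
qed

lemma module_transport:
  assumes "Module.module K L" and bij: "bij_betw \<phi> (carrier V) (carrier L)"
    and add: "\<And>x y. \<lbrakk>x \<in> carrier V; y \<in> carrier V\<rbrakk> \<Longrightarrow> x \<oplus>\<^bsub>V\<^esub> y \<in> carrier V \<and> \<phi> (x \<oplus>\<^bsub>V\<^esub> y) = \<phi> x \<oplus>\<^bsub>L\<^esub> \<phi> y"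
    and zero: "\<zero>\<^bsub>V\<^esub> \<in> carrier V" "\<phi> \<zero>\<^bsub>V\<^esub> = \<zero>\<^bsub>L\<^esub>"
    and smult: "\<And>a x. \<lbrakk>a \<in> carrier K; x \<in> carrier V\<rbrakk> \<Longrightarrow> a \<odot>\<^bsub>V\<^esub> x \<in> carrier V \<and> \<phi> (a \<odot>\<^bsub>V\<^esub> x) = a \<odot>\<^bsub>L\<^esub> \<phi> x"
  shows "Module.module K V"
proof -
  interpret L: Module.module K L by fact
  have inj: "x = y" if "x \<in> carrier V" "y \<in> carrier V" "\<phi> x = \<phi> y" for x y
    using bij that by (auto simp: bij_betw_def inj_on_def)
  have im [simp]: "\<phi> x \<in> carrier L" if "x \<in> carrier V" for x
    using bij that by (auto simp: bij_betw_def)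
  have "\<exists>y\<in>carrier V. y \<oplus>\<^bsub>V\<^esub> x = \<zero>\<^bsub>V\<^esub>" if x: "x \<in> carrier V" for x
  proof -
    obtain y where y: "y \<in> carrier V" "\<phi> y = \<ominus>\<^bsub>L\<^esub> \<phi> x"
      using bij x by (metis L.M.a_inv_closed bij_betw_iff_bijections im)
    then have "y \<oplus>\<^bsub>V\<^esub> x = \<zero>\<^bsub>V\<^esub>"
      using x by (intro inj) (simp_all add: add zero L.M.l_neg)
    then show ?thesis
      using y by blast
  qed
  then have "abelian_group V"
    by (intro abelian_groupI) (auto intro!: inj simp: add zero L.M.a_ac)
  then show ?thesis
    by (intro Module.moduleI[OF L.R.cring_axioms])
      (auto intro!: inj simp: add smult L.smult_l_distr L.smult_r_distr L.smult_assoc1)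
qed

text \<open>The first isomorphism theorem in a form that does not presuppose a module structure on the
  source: the quotient inherits the module laws from the image of \<open>h\<close>.\<close>

lemma module_quotient_kernel:
  assumes "stable_subgroup K F N" "Module.module K L"
    and h: "\<And>x. x \<in> carrier F \<Longrightarrow> h x \<in> carrier L"
      "\<And>x y. \<lbrakk>x \<in> carrier F; y \<in> carrier F\<rbrakk> \<Longrightarrow> h (x \<oplus>\<^bsub>F\<^esub> y) = h x \<oplus>\<^bsub>L\<^esub> h y"
      "\<And>a x. \<lbrakk>a \<in> carrier K; x \<in> carrier F\<rbrakk> \<Longrightarrow> h (a \<odot>\<^bsub>F\<^esub> x) = a \<odot>\<^bsub>L\<^esub> h x"
    and surj: "h ` carrier F = carrier L"
    and kernel: "\<And>x. x \<in> carrier F \<Longrightarrow> x \<in> N \<longleftrightarrow> h x = \<zero>\<^bsub>L\<^esub>"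
  obtains \<phi> where "Module.module K (quotient_module F N)"
    "\<phi> \<in> LinearCombinations.module_hom K (quotient_module F N) L"
    "bij_betw \<phi> (carrier (quotient_module F N)) (carrier L)"
proof -
  interpret F: stable_subgroup K F N by fact
  interpret L: Module.module K L by fact
  let ?V = "quotient_module F N"
  have h0: "h \<zero>\<^bsub>F\<^esub> = \<zero>\<^bsub>L\<^esub>"
    using kernel[of "\<zero>\<^bsub>F\<^esub>"] by simp
  have "h (\<ominus>\<^bsub>F\<^esub> y) = \<ominus>\<^bsub>L\<^esub> h y" if y: "y \<in> carrier F" for y
  proof -
    have "h (\<ominus>\<^bsub>F\<^esub> y) \<oplus>\<^bsub>L\<^esub> h y = h (\<ominus>\<^bsub>F\<^esub> y \<oplus>\<^bsub>F\<^esub> y)"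
      using y by (intro h(2)[symmetric]) simp_all
    also have "\<dots> = \<zero>\<^bsub>L\<^esub>"
      using y h0 by (simp only: F.l_neg)
    finally have "\<ominus>\<^bsub>L\<^esub> h y = h (\<ominus>\<^bsub>F\<^esub> y)"
      using y by (intro L.M.minus_equality h(1)) simp_all
    then show ?thesis by (rule sym)
  qed
  then have h_minus: "h (x \<ominus>\<^bsub>F\<^esub> y) = h x \<ominus>\<^bsub>L\<^esub> h y" if "x \<in> carrier F" "y \<in> carrier F" for x y
    using that by (simp only: a_minus_def h F.add.inv_closed)
  have minus_eq_zero: "u \<ominus>\<^bsub>L\<^esub> v = \<zero>\<^bsub>L\<^esub> \<longleftrightarrow> u = v" if "u \<in> carrier L" "v \<in> carrier L" for u v
    using that L.M.minus_equality[of u "\<ominus>\<^bsub>L\<^esub> v"] by (auto simp: a_minus_def L.M.r_neg)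
  have eq: "N +>\<^bsub>F\<^esub> x = N +>\<^bsub>F\<^esub> y \<longleftrightarrow> h x = h y" if "x \<in> carrier F" "y \<in> carrier F" for x y
    using that by (simp only: F.coset_eq_iff kernel h_minus F.minus_closed h(1) minus_eq_zero)
  define \<phi> where "\<phi> S = h (inv_into (carrier F) (\<lambda>x. N +>\<^bsub>F\<^esub> x) S)" for S
  have \<phi>: "\<phi> (N +>\<^bsub>F\<^esub> x) = h x" if "x \<in> carrier F" for x
  proof -
    define z where "z = inv_into (carrier F) (\<lambda>x. N +>\<^bsub>F\<^esub> x) (N +>\<^bsub>F\<^esub> x)"
    have mem: "N +>\<^bsub>F\<^esub> x \<in> (\<lambda>x. N +>\<^bsub>F\<^esub> x) ` carrier F"
      using that by (rule imageI)
    have "z \<in> carrier F"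
      unfolding z_def using mem by (rule inv_into_into)
    moreover have "N +>\<^bsub>F\<^esub> z = N +>\<^bsub>F\<^esub> x"
      unfolding z_def using mem by (rule f_inv_into_f)
    ultimately have "h z = h x"
      using that by (rule_tac iffD1[OF eq])
    then show ?thesis
      by (simp only: \<phi>_def z_def)
  qed
  have bij: "bij_betw \<phi> (carrier ?V) (carrier L)"
    unfolding bij_betw_def inj_on_def F.quotient_module_carrier image_image
    using surj by (auto simp: \<phi> eq image_iff)
  have add: "x \<oplus>\<^bsub>?V\<^esub> y \<in> carrier ?V \<and> \<phi> (x \<oplus>\<^bsub>?V\<^esub> y) = \<phi> x \<oplus>\<^bsub>L\<^esub> \<phi> y" if "x \<in> carrier ?V" "y \<in> carrier ?V" for x y
    using that by (auto simp: F.quotient_module_carrier F.quotient_module_add \<phi> h)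
  have smult: "a \<odot>\<^bsub>?V\<^esub> x \<in> carrier ?V \<and> \<phi> (a \<odot>\<^bsub>?V\<^esub> x) = a \<odot>\<^bsub>L\<^esub> \<phi> x" if "a \<in> carrier K" "x \<in> carrier ?V" for a x
    using that by (auto simp: F.quotient_module_carrier F.quotient_module_smult \<phi> h F.scalar_closed)
  have "Module.module K ?V"
  proof (rule module_transport[OF L.module_axioms bij add])
    show "\<zero>\<^bsub>?V\<^esub> \<in> carrier ?V" "\<phi> \<zero>\<^bsub>?V\<^esub> = \<zero>\<^bsub>L\<^esub>"
      by (simp_all add: F.quotient_module_zero F.quotient_module_carrier \<phi> h0)
  qed (use smult in auto)
  moreover have "\<phi> \<in> LinearCombinations.module_hom K ?V L"
    using add smult bij by (auto simp: LinearCombinations.module_hom_def bij_betw_def)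
  ultimately show ?thesis
    using bij that by blast
qed

text \<open>The inverse of a linear bijection is linear, so finite generation passes in both directions.\<close>

lemma linear_bij_fin_dim:
  assumes "vectorspace K V" "vectorspace K W" "\<phi> \<in> LinearCombinations.module_hom K V W"
    and bij: "bij_betw \<phi> (carrier V) (carrier W)"
  shows "vectorspace.fin_dim K V \<longleftrightarrow> vectorspace.fin_dim K W"
    and "vectorspace.fin_dim K W \<Longrightarrow> vectorspace.dim K V = vectorspace.dim K W"
proof -
  interpret V: vectorspace K V by fact
  interpret W: vectorspace K W by fact
  interpret linear_map K V W \<phi>
    by unfold_locales fact
  let ?\<psi> = "inv_into (carrier V) \<phi>"
  have \<psi>: "?\<psi> w \<in> carrier V" "\<phi> (?\<psi> w) = w" if "w \<in> carrier W" for w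
    using bij that by (auto simp: bij_betw_def inv_into_into f_inv_into_f)
  have inj: "x = y" if "x \<in> carrier V" "y \<in> carrier V" "\<phi> x = \<phi> y" for x y
    using bij that by (auto simp: bij_betw_def inj_on_def)
  have "?\<psi> \<in> LinearCombinations.module_hom K W V"
    unfolding LinearCombinations.module_hom_def
  proof (intro CollectI conjI allI impI funcsetI; (elim conjE)?)
    fix v w assume "v \<in> carrier W" "w \<in> carrier W"
    then show "?\<psi> (v \<oplus>\<^bsub>W\<^esub> w) = ?\<psi> v \<oplus>\<^bsub>V\<^esub> ?\<psi> w"
      by (intro inj) (simp_all add: \<psi>)
  next
    fix a w assume "a \<in> carrier K" "w \<in> carrier W"
    then show "?\<psi> (a \<odot>\<^bsub>W\<^esub> w) = a \<odot>\<^bsub>V\<^esub> ?\<psi> w"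
      by (intro inj) (simp_all add: \<psi>)
  qed (rule \<psi>)
  then interpret I: linear_map K W V ?\<psi>
    by unfold_locales
  have "?\<psi> ` carrier W = carrier V"
    by (rule bij_betw_imp_surj_on[OF bij_betw_inv_into[OF bij]])
  then show iff: "V.fin_dim \<longleftrightarrow> W.fin_dim"
    using I.surj_fin_dim surj_fin_dim bij by (auto simp: bij_betw_def)
  show "W.fin_dim \<Longrightarrow> V.dim = W.dim"
    using iff dim_eq bij by (auto simp: bij_betw_def)
qed

section \<open>The tensor product with the field of quotients\<close>

lemma hom_free_Abelian_group:
  assumes "abelian_group L" and h: "h \<in> hom (free_Abelian_group S) (add_monoid L)"
  shows "Poly_Mapping.keys c \<subseteq> S \<Longrightarrow> h c \<in> carrier L"
    and "\<lbrakk>Poly_Mapping.keys c \<subseteq> S; Poly_Mapping.keys d \<subseteq> S\<rbrakk> \<Longrightarrow> h (c + d) = h c \<oplus>\<^bsub>L\<^esub> h d"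
    and "\<lbrakk>Poly_Mapping.keys c \<subseteq> S; Poly_Mapping.keys d \<subseteq> S\<rbrakk> \<Longrightarrow> h (c - d) = h c \<ominus>\<^bsub>L\<^esub> h d"
proof -
  interpret L: abelian_group L by fact
  interpret h: group_hom "free_Abelian_group S" "add_monoid L" h
    using h by (intro group_hom.intro group_hom_axioms.intro) (simp_all add: L.a_group)
  have neg: "h (- d) = \<ominus>\<^bsub>L\<^esub> h d" if "Poly_Mapping.keys d \<subseteq> S" for d
    using that h.hom_inv[of d] by (simp add: a_inv_def)
  show closed: "Poly_Mapping.keys c \<subseteq> S \<Longrightarrow> h c \<in> carrier L"
    using h.hom_closed[of c] by simp
  have add: "h (c + d) = h c \<oplus>\<^bsub>L\<^esub> h d" if "Poly_Mapping.keys c \<subseteq> S" "Poly_Mapping.keys d \<subseteq> S" for c d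
    using that h.hom_mult[of c d] by simp
  then show "\<lbrakk>Poly_Mapping.keys c \<subseteq> S; Poly_Mapping.keys d \<subseteq> S\<rbrakk> \<Longrightarrow> h (c + d) = h c \<oplus>\<^bsub>L\<^esub> h d" .
  show "\<lbrakk>Poly_Mapping.keys c \<subseteq> S; Poly_Mapping.keys d \<subseteq> S\<rbrakk> \<Longrightarrow> h (c - d) = h c \<ominus>\<^bsub>L\<^esub> h d"
    using add[of c "- d"] neg[of d] by (simp add: a_minus_def)
qed

context module_over_domain
begin

abbreviation tensor_generators :: "('c \<times> ('a \<times> 'a) set) set" where
  "tensor_generators \<equiv> carrier M \<times> carrier (quotient_field R)"

text \<open>The subgroup of bilinearity relations, that is, the formal sums that represent zero.\<close>

definition tensor_kernel :: "(('c \<times> ('a \<times> 'a) set) \<Rightarrow>\<^sub>0 int) set" where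
  "tensor_kernel = generate (free_Abelian_group tensor_generators) (tensor_relations R M)"

lemma tensor_quotient_field_eq: "tensor_quotient_field R M = quotient_module (tensor_free R M) tensor_kernel"
  by (simp add: tensor_quotient_field_def tensor_kernel_def)

lemma tensor_free_simps:
  "c \<in> carrier (tensor_free R M) \<longleftrightarrow> Poly_Mapping.keys c \<subseteq> tensor_generators"
  "c \<oplus>\<^bsub>tensor_free R M\<^esub> d = c + d" "\<zero>\<^bsub>tensor_free R M\<^esub> = 0"
  "q \<odot>\<^bsub>tensor_free R M\<^esub> c = frag_extend (\<lambda>(x, p). frag_of (x, q \<otimes>\<^bsub>quotient_field R\<^esub> p)) c"
  by (simp_all add: tensor_free_def)

lemma abelian_group_tensor_free: "abelian_group (tensor_free R M)"
proof (rule abelian_groupI)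
  fix c assume c: "c \<in> carrier (tensor_free R M)"
  show "\<exists>d\<in>carrier (tensor_free R M). d \<oplus>\<^bsub>tensor_free R M\<^esub> c = \<zero>\<^bsub>tensor_free R M\<^esub>"
    using c by (intro bexI[of _ "- c"]) (simp_all only: tensor_free_simps keys_minus left_minus)
qed (use keys_add in \<open>fastforce simp: tensor_free_simps\<close>)+

lemma tensor_relations_subset: "tensor_relations R M \<subseteq> {c. Poly_Mapping.keys c \<subseteq> tensor_generators}"
proof -
  interpret Q: field "quotient_field R" by (rule field_quotient_field)
  have sub: "Poly_Mapping.keys (a - b) \<subseteq> tensor_generators" "Poly_Mapping.keys (a + b) \<subseteq> tensor_generators"
    if "Poly_Mapping.keys a \<subseteq> tensor_generators" "Poly_Mapping.keys b \<subseteq> tensor_generators" 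
    for a b :: "('c \<times> ('a \<times> 'a) set) \<Rightarrow>\<^sub>0 int"
    using that keys_diff[of a b] keys_add[of a b] by blast+
  show ?thesis
    unfolding tensor_relations_def
    by (rule subsetI; elim UnE CollectE exE conjE; hypsubst; intro CollectI sub; simp)
qed

lemma tensor_kernel_subgroup: "subgroup tensor_kernel (free_Abelian_group tensor_generators)"
  unfolding tensor_kernel_def using tensor_relations_subset
  by (intro group.generate_is_subgroup) auto

lemma tensor_kernel_zero: "0 \<in> tensor_kernel"
  using subgroup.one_closed[OF tensor_kernel_subgroup] by simp

lemma tensor_kernel_carrier: "c \<in> tensor_kernel \<Longrightarrow> Poly_Mapping.keys c \<subseteq> tensor_generators"
  using subgroup.mem_carrier[OF tensor_kernel_subgroup] by simp

lemma tensor_kernel_add: "\<lbrakk>c \<in> tensor_kernel; d \<in> tensor_kernel\<rbrakk> \<Longrightarrow> c + d \<in> tensor_kernel"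
  using subgroup.m_closed[OF tensor_kernel_subgroup] by simp

lemma tensor_kernel_uminus: "c \<in> tensor_kernel \<Longrightarrow> - c \<in> tensor_kernel"
  using subgroup.m_inv_closed[OF tensor_kernel_subgroup] tensor_kernel_carrier by simp

lemma tensor_kernel_diff: "\<lbrakk>c \<in> tensor_kernel; d \<in> tensor_kernel\<rbrakk> \<Longrightarrow> c - d \<in> tensor_kernel"
  using tensor_kernel_add[of c "- d"] tensor_kernel_uminus by simp

lemma tensor_kernel_relation: "c \<in> tensor_relations R M \<Longrightarrow> c \<in> tensor_kernel"
  unfolding tensor_kernel_def by (rule generate.incl)

lemma tensor_add_left:
  "\<lbrakk>x \<in> carrier M; y \<in> carrier M; p \<in> carrier (quotient_field R)\<rbrakk> \<Longrightarrow>
    frag_of (x \<oplus>\<^bsub>M\<^esub> y, p) - (frag_of (x, p) + frag_of (y, p)) \<in> tensor_kernel"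
  by (intro tensor_kernel_relation) (auto simp: tensor_relations_def)

lemma tensor_scalar:
  "\<lbrakk>r \<in> carrier R; x \<in> carrier M; p \<in> carrier (quotient_field R)\<rbrakk> \<Longrightarrow>
    frag_of (r \<odot>\<^bsub>M\<^esub> x, p) - frag_of (x, fraction R r \<one> \<otimes>\<^bsub>quotient_field R\<^esub> p) \<in> tensor_kernel"
  by (intro tensor_kernel_relation) (auto simp: tensor_relations_def)

lemma tensor_fraction:
  assumes "a \<in> carrier R" "b \<in> denominators" "x \<in> carrier M"
  shows "frag_of (x, fraction R a b) - frag_of (a \<odot>\<^bsub>M\<^esub> x, fraction R \<one> b) \<in> tensor_kernel"
  using tensor_kernel_uminus[OF tensor_scalar[of a x "fraction R \<one> b"]] assms
  by (simp add: fraction_mult)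

lemma tensor_expand:
  assumes "x \<in> carrier M" "s \<in> denominators" "t \<in> denominators"
  shows "frag_of (x, fraction R \<one> s) - frag_of (t \<odot>\<^bsub>M\<^esub> x, fraction R \<one> (t \<otimes> s)) \<in> tensor_kernel"
proof -
  have "fraction R t (t \<otimes> s) = fraction R \<one> s"
    using fraction_expand[of \<one> s t] assms by simp
  then show ?thesis
    using tensor_fraction[of t "t \<otimes> s" x] assms by (simp add: integral_iff)
qed

lemma tensor_zero_left:
  assumes "p \<in> carrier (quotient_field R)"
  shows "frag_of (\<zero>\<^bsub>M\<^esub>, p) \<in> tensor_kernel"
  using tensor_kernel_uminus[OF tensor_add_left[of "\<zero>\<^bsub>M\<^esub>" "\<zero>\<^bsub>M\<^esub>" p]] assms by simp

lemma tensor_diff_left: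
  assumes "x \<in> carrier M" "y \<in> carrier M" "p \<in> carrier (quotient_field R)"
  shows "frag_of (x, p) - frag_of (y, p) - frag_of (x \<ominus>\<^bsub>M\<^esub> y, p) \<in> tensor_kernel"
proof -
  have "x \<ominus>\<^bsub>M\<^esub> y \<oplus>\<^bsub>M\<^esub> y = x"
    using assms by (simp add: a_minus_def M.a_assoc M.l_neg)
  then show ?thesis
    using tensor_add_left[of "x \<ominus>\<^bsub>M\<^esub> y" y p] assms by (simp add: algebra_simps)
qed

text \<open>Scalars move across the tensor sign, so all second components can be given the form \<open>1 / s\<close>
  with one and the same \<open>s\<close>; additivity on the left then merges a formal sum into a single tensor.\<close>

lemma simple_tensor:
  assumes "Poly_Mapping.keys c \<subseteq> tensor_generators"
  obtains x s where "x \<in> carrier M" "s \<in> denominators" "c - frag_of (x, fraction R \<one> s) \<in> tensor_kernel"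
proof -
  have "\<exists>x s. x \<in> carrier M \<and> s \<in> denominators \<and> c - frag_of (x, fraction R \<one> s) \<in> tensor_kernel"
    using assms
  proof (induction rule: free_Abelian_group_induct[consumes 1, case_names zero diff generator])
    case zero
    have "0 - frag_of (\<zero>\<^bsub>M\<^esub>, fraction R \<one> \<one>) \<in> tensor_kernel"
      by (intro tensor_kernel_diff tensor_kernel_zero tensor_zero_left) simp
    then show ?case
      using M.zero_closed one_denominator by blast
  next
    case (diff c d)
    obtain x s where x: "x \<in> carrier M" "s \<in> denominators" "c - frag_of (x, fraction R \<one> s) \<in> tensor_kernel"
      using diff by blast
    obtain y t where y: "y \<in> carrier M" "t \<in> denominators" "d - frag_of (y, fraction R \<one> t) \<in> tensor_kernel"
      using diff by blast
    have st: "s \<otimes> t \<in> denominators"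
      using x y by (simp add: integral_iff)
    let ?X = "frag_of (t \<odot>\<^bsub>M\<^esub> x, fraction R \<one> (s \<otimes> t))" and ?Y = "frag_of (s \<odot>\<^bsub>M\<^esub> y, fraction R \<one> (s \<otimes> t))"
      and ?Z = "frag_of (t \<odot>\<^bsub>M\<^esub> x \<ominus>\<^bsub>M\<^esub> s \<odot>\<^bsub>M\<^esub> y, fraction R \<one> (s \<otimes> t))"
    have "c - ?X \<in> tensor_kernel"
      using tensor_kernel_add[OF x(3) tensor_expand[OF x(1,2) y(2)]] x y by (simp add: m_comm)
    moreover have "d - ?Y \<in> tensor_kernel"
      using tensor_kernel_add[OF y(3) tensor_expand[OF y(1,2) x(2)]] by simp
    moreover have "?X - ?Y - ?Z \<in> tensor_kernel"
      using x y st by (intro tensor_diff_left) simp_all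
    ultimately have "(c - ?X) - (d - ?Y) + (?X - ?Y - ?Z) \<in> tensor_kernel"
      by (rule tensor_kernel_add[OF tensor_kernel_diff])
    then have "c - d - ?Z \<in> tensor_kernel"
      by (simp add: algebra_simps)
    then show ?case
      using x y st by (intro exI[of _ "t \<odot>\<^bsub>M\<^esub> x \<ominus>\<^bsub>M\<^esub> s \<odot>\<^bsub>M\<^esub> y"] exI[of _ "s \<otimes> t"]) simp
  next
    case (generator g)
    then obtain x p where g: "g = (x, p)" "x \<in> carrier M" "p \<in> carrier (quotient_field R)"
      by blast
    obtain a b where "a \<in> carrier R" "b \<in> denominators" "p = fraction R a b"
      using g(3) by (rule fractionE)
    then show ?case
      using g tensor_fraction[of a b x] by (intro exI[of _ "a \<odot>\<^bsub>M\<^esub> x"] exI[of _ b]) simp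
  qed
  then show ?thesis
    using that by blast
qed

text \<open>The tensor \<open>x \<otimes> 1 / s\<close> equals \<open>u x \<otimes> 1 / (u s)\<close>, which has a vanishing left factor.\<close>

lemma torsion_tensor_zero:
  assumes "x \<in> carrier M" "s \<in> denominators" "u \<in> denominators" "u \<odot>\<^bsub>M\<^esub> x = \<zero>\<^bsub>M\<^esub>"
  shows "frag_of (x, fraction R \<one> s) \<in> tensor_kernel"
  using tensor_kernel_add[OF tensor_expand[OF assms(1,2,3)] tensor_zero_left[of "fraction R \<one> (u \<otimes> s)"]] assms
  by (simp add: integral_iff)

text \<open>The bilinear map \<open>(x, p) \<mapsto> p (x / 1)\<close> respects the defining relations of the tensor product.\<close>

lemma tensor_to_localization:
  obtains h where "h \<in> hom (free_Abelian_group tensor_generators) (add_monoid (localization R M))"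
    "\<forall>x\<in>carrier M. \<forall>p\<in>carrier (quotient_field R). h (frag_of (x, p)) = p \<odot>\<^bsub>localization R M\<^esub> mfrac R M x \<one>"
    "\<forall>c\<in>tensor_kernel. h c = \<zero>\<^bsub>localization R M\<^esub>"
proof -
  let ?L = "localization R M" and ?Q = "quotient_field R" and ?F = "free_Abelian_group tensor_generators"
  interpret L: vectorspace ?Q ?L by (rule vectorspace_localization)
  have "(\<lambda>(x, p). p \<odot>\<^bsub>?L\<^esub> mfrac R M x \<one>) ` tensor_generators \<subseteq> carrier (add_monoid ?L)"
    by auto
  then obtain h where h: "h \<in> hom ?F (add_monoid ?L)"
      "\<And>g. g \<in> tensor_generators \<Longrightarrow> h (frag_of g) = (\<lambda>(x, p). p \<odot>\<^bsub>?L\<^esub> mfrac R M x \<one>) g"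
    using comm_group.free_Abelian_group_universal[OF L.M.a_comm_group] by blast
  interpret h: group_hom ?F "add_monoid ?L" h
    using h(1) by (intro group_hom.intro group_hom_axioms.intro) (simp_all add: L.M.a_group)
  note add = hom_free_Abelian_group(2)[OF L.M.abelian_group_axioms h(1)]
    and diff = hom_free_Abelian_group(3)[OF L.M.abelian_group_axioms h(1)]
  have of: "h (frag_of (x, p)) = p \<odot>\<^bsub>?L\<^esub> mfrac R M x \<one>" if "x \<in> carrier M" "p \<in> carrier ?Q" for x p
    using that h(2)[of "(x, p)"] by simp
  have self: "v \<ominus>\<^bsub>?L\<^esub> v = \<zero>\<^bsub>?L\<^esub>" if "v \<in> carrier ?L" for v
    using that by (simp add: a_minus_def L.M.r_neg)
  have keys: "Poly_Mapping.keys (frag_of (x, p) + frag_of (y, q)) \<subseteq> tensor_generators"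
    if "(x, p) \<in> tensor_generators" "(y, q) \<in> tensor_generators" for x y p q
    using that keys_add[of "frag_of (x, p)" "frag_of (y, q)"] by auto
  have rel: "h c = \<zero>\<^bsub>?L\<^esub>" if "c \<in> tensor_relations R M" for c
    using that unfolding tensor_relations_def
  proof (elim UnE CollectE exE conjE)
    fix x y p assume "c = frag_of (x \<oplus>\<^bsub>M\<^esub> y, p) - (frag_of (x, p) + frag_of (y, p))"
      "x \<in> carrier M" "y \<in> carrier M" "p \<in> carrier ?Q"
    then show ?thesis
      using L.smult_r_distr[of p "mfrac R M x \<one>" "mfrac R M y \<one>"]
      by (simp add: diff add keys of mfrac_add self)
  next
    fix x p q assume "c = frag_of (x, p \<oplus>\<^bsub>?Q\<^esub> q) - (frag_of (x, p) + frag_of (x, q))"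
      "x \<in> carrier M" "p \<in> carrier ?Q" "q \<in> carrier ?Q"
    then show ?thesis
      by (simp add: diff add keys of L.smult_l_distr self)
  next
    fix r x p assume C: "c = frag_of (r \<odot>\<^bsub>M\<^esub> x, p) - frag_of (x, fraction R r \<one> \<otimes>\<^bsub>?Q\<^esub> p)"
      "r \<in> carrier R" "x \<in> carrier M" "p \<in> carrier ?Q"
    have "mfrac R M (r \<odot>\<^bsub>M\<^esub> x) \<one> = fraction R r \<one> \<odot>\<^bsub>?L\<^esub> mfrac R M x \<one>"
      using C by (simp add: mfrac_smult)
    then have "p \<odot>\<^bsub>?L\<^esub> mfrac R M (r \<odot>\<^bsub>M\<^esub> x) \<one> = (fraction R r \<one> \<otimes>\<^bsub>?Q\<^esub> p) \<odot>\<^bsub>?L\<^esub> mfrac R M x \<one>"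
      using C L.smult_assoc1[of p "fraction R r \<one>" "mfrac R M x \<one>"] by (simp add: L.R.m_comm)
    then show ?thesis
      using C by (simp add: diff of self)
  qed
  have "tensor_kernel \<subseteq> kernel ?F (add_monoid ?L) h"
    unfolding tensor_kernel_def
    by (rule group.generate_subgroup_incl[OF group_free_Abelian_group _ h.subgroup_kernel])
      (use rel tensor_relations_subset in \<open>auto simp: kernel_def\<close>)
  then have "\<forall>c\<in>tensor_kernel. h c = \<zero>\<^bsub>?L\<^esub>"
    by (auto simp: kernel_def)
  then show ?thesis
    using that[of h] h(1) of by blast
qed

text \<open>The map to the localization sends \<open>x \<otimes> 1 / s\<close> to \<open>x / s\<close>. As every element is a tensor of
  this form, its vanishing forces \<open>x\<close> to be torsion, and then the tensor vanishes as well.\<close>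

lemma tensor_iso_localization:
  obtains \<phi> where "vectorspace (quotient_field R) (tensor_quotient_field R M)"
    "\<phi> \<in> LinearCombinations.module_hom (quotient_field R) (tensor_quotient_field R M) (localization R M)"
    "bij_betw \<phi> (carrier (tensor_quotient_field R M)) (carrier (localization R M))"
proof -
  let ?L = "localization R M" and ?Q = "quotient_field R" and ?F = "tensor_free R M"
  interpret L: vectorspace ?Q ?L by (rule vectorspace_localization)
  obtain h where h: "h \<in> hom (free_Abelian_group tensor_generators) (add_monoid ?L)"
    and of: "\<forall>x\<in>carrier M. \<forall>p\<in>carrier ?Q. h (frag_of (x, p)) = p \<odot>\<^bsub>?L\<^esub> mfrac R M x \<one>"
    and "\<forall>c\<in>tensor_kernel. h c = \<zero>\<^bsub>?L\<^esub>"
    by (rule tensor_to_localization)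
  then have zero_kernel: "h c = \<zero>\<^bsub>?L\<^esub>" if "c \<in> tensor_kernel" for c
    using that by blast
  note closed = hom_free_Abelian_group(1)[OF L.M.abelian_group_axioms h]
    and add = hom_free_Abelian_group(2)[OF L.M.abelian_group_axioms h]
    and h_diff = hom_free_Abelian_group(3)[OF L.M.abelian_group_axioms h]
  have of': "h (frag_of (x, fraction R \<one> s)) = mfrac R M x s" if "x \<in> carrier M" "s \<in> denominators" for x s
    using that by (simp add: of mfrac_smult)
  have keys_smult: "Poly_Mapping.keys (q \<odot>\<^bsub>?F\<^esub> c) \<subseteq> tensor_generators"
    and smult: "h (q \<odot>\<^bsub>?F\<^esub> c) = q \<odot>\<^bsub>?L\<^esub> h c"
    if q: "q \<in> carrier ?Q" and c: "Poly_Mapping.keys c \<subseteq> tensor_generators" for q c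
  proof -
    have "Poly_Mapping.keys (q \<odot>\<^bsub>?F\<^esub> c) \<subseteq> tensor_generators \<and> h (q \<odot>\<^bsub>?F\<^esub> c) = q \<odot>\<^bsub>?L\<^esub> h c"
      using c
    proof (induction rule: free_Abelian_group_induct[consumes 1, case_names zero diff generator])
      case zero
      then show ?case
        using q zero_kernel[OF tensor_kernel_zero] by (simp add: tensor_free_simps)
    next
      case (diff c d)
      have "q \<odot>\<^bsub>?F\<^esub> (c - d) = q \<odot>\<^bsub>?F\<^esub> c - q \<odot>\<^bsub>?F\<^esub> d"
        by (simp add: tensor_free_simps frag_extend_diff)
      moreover have "q \<odot>\<^bsub>?L\<^esub> (h c \<ominus>\<^bsub>?L\<^esub> h d) = q \<odot>\<^bsub>?L\<^esub> h c \<ominus>\<^bsub>?L\<^esub> q \<odot>\<^bsub>?L\<^esub> h d"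
        using diff.hyps q closed by (simp add: a_minus_def L.smult_r_distr L.smult_r_minus)
      ultimately show ?case
        using diff.IH diff.hyps h_diff keys_diff[of "q \<odot>\<^bsub>?F\<^esub> c" "q \<odot>\<^bsub>?F\<^esub> d"] by auto
    next
      case (generator g)
      then obtain x p where g: "g = (x, p)" "x \<in> carrier M" "p \<in> carrier ?Q"
        by auto
      then show ?case
        using q by (simp add: tensor_free_simps of L.smult_assoc1)
    qed
    then show "Poly_Mapping.keys (q \<odot>\<^bsub>?F\<^esub> c) \<subseteq> tensor_generators" "h (q \<odot>\<^bsub>?F\<^esub> c) = q \<odot>\<^bsub>?L\<^esub> h c"
      by auto
  qed
  have kernel: "c \<in> tensor_kernel \<longleftrightarrow> h c = \<zero>\<^bsub>?L\<^esub>" if c: "Poly_Mapping.keys c \<subseteq> tensor_generators" for c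
  proof
    assume hc: "h c = \<zero>\<^bsub>?L\<^esub>"
    obtain x s where xs: "x \<in> carrier M" "s \<in> denominators" and k: "c - frag_of (x, fraction R \<one> s) \<in> tensor_kernel"
      using c by (rule simple_tensor)
    have "h c = h (c - frag_of (x, fraction R \<one> s)) \<oplus>\<^bsub>?L\<^esub> h (frag_of (x, fraction R \<one> s))"
      using add[of "c - frag_of (x, fraction R \<one> s)" "frag_of (x, fraction R \<one> s)"]
        tensor_kernel_carrier[OF k] xs by simp
    then have "mfrac R M x s = \<zero>\<^bsub>?L\<^esub>"
      using zero_kernel[OF k] hc xs by (simp add: of')
    then obtain u where "u \<in> denominators" "u \<odot>\<^bsub>M\<^esub> x = \<zero>\<^bsub>M\<^esub>"
      using xs mfrac_eq_zero_iff by blast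
    then have "frag_of (x, fraction R \<one> s) \<in> tensor_kernel"
      using xs torsion_tensor_zero by blast
    then show "c \<in> tensor_kernel"
      using tensor_kernel_add[OF k, of "frag_of (x, fraction R \<one> s)"] by simp
  qed (rule zero_kernel)
  have "additive_subgroup tensor_kernel ?F"
  proof (rule additive_subgroup.intro, rule subgroup.intro)
    interpret F: abelian_group ?F by (rule abelian_group_tensor_free)
    fix c assume c: "c \<in> tensor_kernel"
    have "\<ominus>\<^bsub>?F\<^esub> c = - c"
      using tensor_kernel_carrier[OF c] by (intro F.minus_equality) (simp_all add: tensor_free_simps)
    then show "inv\<^bsub>add_monoid ?F\<^esub> c \<in> tensor_kernel"
      using tensor_kernel_uminus[OF c] by (simp add: a_inv_def)
  qed (use tensor_kernel_carrier tensor_kernel_add tensor_kernel_zero in \<open>auto simp: tensor_free_simps(1-3)\<close>)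
  then have "stable_subgroup ?Q ?F tensor_kernel"
  proof (intro stable_subgroup.intro abelian_group_tensor_free stable_subgroup_axioms.intro)
    fix q c assume q: "q \<in> carrier ?Q" and c: "c \<in> tensor_kernel"
    note keys = tensor_kernel_carrier[OF c]
    have "h (q \<odot>\<^bsub>?F\<^esub> c) = \<zero>\<^bsub>?L\<^esub>"
      using q by (simp only: smult[OF q keys] zero_kernel[OF c] L.smult_r_null)
    then show "q \<odot>\<^bsub>?F\<^esub> c \<in> tensor_kernel"
      by (rule iffD2[OF kernel[OF keys_smult[OF q keys]]])
  next
    fix q c d assume "q \<in> carrier ?Q" "c \<in> carrier ?F" "d \<in> carrier ?F"
    then show "q \<odot>\<^bsub>?F\<^esub> (c \<oplus>\<^bsub>?F\<^esub> d) = q \<odot>\<^bsub>?F\<^esub> c \<oplus>\<^bsub>?F\<^esub> q \<odot>\<^bsub>?F\<^esub> d"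
      by (simp add: tensor_free_simps frag_extend_add)
  next
    fix q c assume q: "q \<in> carrier ?Q" and c: "c \<in> carrier ?F"
    show "q \<odot>\<^bsub>?F\<^esub> c \<in> carrier ?F"
      using keys_smult[OF q c[unfolded tensor_free_simps(1)]] by (rule tensor_free_simps(1)[THEN iffD2])
  qed
  moreover have "h ` carrier ?F = carrier ?L"
  proof
    show "carrier ?L \<subseteq> h ` carrier ?F"
    proof
      fix v assume "v \<in> carrier ?L"
      then obtain x s where "x \<in> carrier M" "s \<in> denominators" "v = mfrac R M x s"
        by (rule mfracE)
      then show "v \<in> h ` carrier ?F"
        by (intro image_eqI[of _ _ "frag_of (x, fraction R \<one> s)"]) (simp_all add: of' tensor_free_simps)
    qed
  qed (auto simp: tensor_free_simps closed)
  ultimately obtain \<phi> where "Module.module ?Q (quotient_module ?F tensor_kernel)"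
      "\<phi> \<in> LinearCombinations.module_hom ?Q (quotient_module ?F tensor_kernel) ?L"
      "bij_betw \<phi> (carrier (quotient_module ?F tensor_kernel)) (carrier ?L)"
    using closed add smult kernel
    by (elim module_quotient_kernel[where h = h, OF _ L.module_axioms]) (simp_all add: tensor_free_simps(1,2))
  then show ?thesis
    using that[of \<phi>] by (simp add: tensor_quotient_field_eq vectorspace.intro field_quotient_field)
qed

lemma has_finite_rank_iff: "has_finite_rank R M \<longleftrightarrow> vectorspace.fin_dim (quotient_field R) (localization R M)"
  and module_rank_eq: "has_finite_rank R M \<Longrightarrow>
    module_rank R M = vectorspace.dim (quotient_field R) (localization R M)"
  using tensor_iso_localization linear_bij_fin_dim vectorspace_localization
  unfolding has_finite_rank_def module_rank_def by metis+

end

section \<open>Ranks along exact sequences\<close>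

definition localization_map :: "('a, 'z) ring_scheme \<Rightarrow> ('a, 'n, 'f) module_scheme \<Rightarrow> ('m \<Rightarrow> 'n)
    \<Rightarrow> ('m \<times> 'a) set \<Rightarrow> ('n \<times> 'a) set" where
  "localization_map R N f S = (\<Union>(x, s)\<in>S. mfrac R N (f x) s)"

text \<open>The rank of the image of \<open>f\<close>, computed after localization.\<close>

definition map_rank :: "('a, 'z) ring_scheme \<Rightarrow> ('a, 'm, 'e) module_scheme \<Rightarrow> ('a, 'n, 'f) module_scheme
    \<Rightarrow> ('m \<Rightarrow> 'n) \<Rightarrow> nat" where
  "map_rank R M N f = vectorspace.dim (quotient_field R)
     ((localization R N)\<lparr>carrier := localization_map R N f ` carrier (localization R M)\<rparr>)"

locale linear_map_over_domain =
  M: module_over_domain R M + N: module_over_domain R N + mod_hom R M N f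
  for R (structure) and M and N and f
begin

lemma localization_map_mfrac:
  assumes "x \<in> carrier M" "s \<in> M.denominators"
  shows "localization_map R N f (mfrac R M x s) = mfrac R N (f x) s"
  unfolding localization_map_def
proof (rule SUP_eq_const)
  show "mfrac R M x s \<noteq> {}"
    using assms M.one_denominator by (auto simp: mfrac_def)
  fix p assume "p \<in> mfrac R M x s"
  then obtain y t u where p: "p = (y, t)" "y \<in> carrier M" "t \<in> M.denominators" "u \<in> M.denominators"
    and eq: "(u \<otimes> t) \<odot>\<^bsub>M\<^esub> x = (u \<otimes> s) \<odot>\<^bsub>M\<^esub> y"
    by (auto simp: mfrac_def)
  have "(u \<otimes> t) \<odot>\<^bsub>N\<^esub> f x = f ((u \<otimes> t) \<odot>\<^bsub>M\<^esub> x)"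
    using p(2-4) assms by simp
  also have "\<dots> = f ((u \<otimes> s) \<odot>\<^bsub>M\<^esub> y)"
    by (simp only: eq)
  also have "\<dots> = (u \<otimes> s) \<odot>\<^bsub>N\<^esub> f y"
    using p(2-4) assms by simp
  finally have "mfrac R N (f x) s = mfrac R N (f y) t"
    using p(2-4) assms by (subst N.mfrac_eq_iff) auto
  then show "(case p of (x, s) \<Rightarrow> mfrac R N (f x) s) = mfrac R N (f x) s"
    by (simp add: p(1))
qed

lemma linear_localization_map:
  "linear_map (quotient_field R) (localization R M) (localization R N) (localization_map R N f)"
proof -
  let ?Q = "quotient_field R" and ?F = "localization_map R N f"
  interpret LM: vectorspace ?Q "localization R M" by (rule M.vectorspace_localization)
  interpret LN: vectorspace ?Q "localization R N" by (rule N.vectorspace_localization)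
  have "?F \<in> LinearCombinations.module_hom ?Q (localization R M) (localization R N)"
    unfolding LinearCombinations.module_hom_def
  proof (intro CollectI conjI allI impI funcsetI; (elim conjE)?)
    fix v assume "v \<in> carrier (localization R M)"
    then obtain x s where "x \<in> carrier M" "s \<in> M.denominators" "v = mfrac R M x s"
      by (rule M.mfracE)
    then show "?F v \<in> carrier (localization R N)"
      by (simp add: localization_map_mfrac)
  next
    fix v w assume "v \<in> carrier (localization R M)" "w \<in> carrier (localization R M)"
    then obtain x y s where "x \<in> carrier M" "y \<in> carrier M" "s \<in> M.denominators"
      "v = mfrac R M x s" "w = mfrac R M y s"
      by (rule M.mfrac_common_denominator2)
    then show "?F (v \<oplus>\<^bsub>localization R M\<^esub> w) = ?F v \<oplus>\<^bsub>localization R N\<^esub> ?F w"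
      by (simp add: localization_map_mfrac M.mfrac_add N.mfrac_add)
  next
    fix q v assume q: "q \<in> carrier ?Q" and v: "v \<in> carrier (localization R M)"
    obtain a b where "a \<in> carrier R" "b \<in> M.denominators" "q = fraction R a b"
      using q by (rule M.fractionE)
    moreover obtain x s where "x \<in> carrier M" "s \<in> M.denominators" "v = mfrac R M x s"
      using v by (rule M.mfracE)
    ultimately show "?F (q \<odot>\<^bsub>localization R M\<^esub> v) = q \<odot>\<^bsub>localization R N\<^esub> ?F v"
      by (simp add: localization_map_mfrac M.mfrac_smult N.mfrac_smult M.integral_iff)
  qed
  then show ?thesis
    by unfold_locales
qed

lemma localization_map_eq_zero_iff:
  assumes "x \<in> carrier M" "s \<in> M.denominators"
  shows "localization_map R N f (mfrac R M x s) = \<zero>\<^bsub>localization R N\<^esub> \<longleftrightarrow>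
    (\<exists>u\<in>M.denominators. f (u \<odot>\<^bsub>M\<^esub> x) = \<zero>\<^bsub>N\<^esub>)"
  using assms by (auto simp: localization_map_mfrac N.mfrac_eq_zero_iff)

lemma map_rank_surj:
  assumes "f ` carrier M = carrier N" "has_finite_rank R N"
  shows "map_rank R M N f = module_rank R N"
proof -
  have "localization_map R N f ` carrier (localization R M) = carrier (localization R N)" (is "?I = _")
  proof
    show "?I \<subseteq> carrier (localization R N)"
      using linear_map.T_im[OF linear_localization_map] by blast
    show "carrier (localization R N) \<subseteq> ?I"
    proof
      fix w assume "w \<in> carrier (localization R N)"
      then obtain y s where "y \<in> carrier N" "s \<in> M.denominators" "w = mfrac R N y s"
        by (rule N.mfracE)
      moreover from this obtain x where "x \<in> carrier M" "y = f x"
        using assms(1) by blast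
      ultimately show "w \<in> ?I"
        by (intro image_eqI[of _ _ "mfrac R M x s"]) (simp_all add: localization_map_mfrac)
    qed
  qed
  then show ?thesis
    using assms(2) by (simp add: map_rank_def N.module_rank_eq)
qed

lemma module_rank_bij:
  assumes "bij_betw f (carrier M) (carrier N)"
  shows "has_finite_rank R M \<longleftrightarrow> has_finite_rank R N"
    and "has_finite_rank R N \<Longrightarrow> module_rank R M = module_rank R N"
proof -
  let ?F = "localization_map R N f"
  interpret F: linear_map "quotient_field R" "localization R M" "localization R N" ?F
    by (rule linear_localization_map)
  have "F.ker = {\<zero>\<^bsub>localization R M\<^esub>}"
  proof (intro equalityI subsetI)
    fix v assume "v \<in> F.ker"
    then have v: "v \<in> carrier (localization R M)" "?F v = \<zero>\<^bsub>localization R N\<^esub>"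
      by (auto simp: F.ker_def)
    obtain x s where x: "x \<in> carrier M" "s \<in> M.denominators" "v = mfrac R M x s"
      using v(1) by (rule M.mfracE)
    then obtain u where u: "u \<in> M.denominators" "f (u \<odot>\<^bsub>M\<^esub> x) = f \<zero>\<^bsub>M\<^esub>"
      using v(2) localization_map_eq_zero_iff by auto
    moreover have "inj_on f (carrier M)"
      using assms by (simp add: bij_betw_def)
    ultimately have "u \<odot>\<^bsub>M\<^esub> x = \<zero>\<^bsub>M\<^esub>"
      using x by (intro inj_onD[of f "carrier M"]) simp_all
    then show "v \<in> {\<zero>\<^bsub>localization R M\<^esub>}"
      using x u M.mfrac_eq_zero_iff by blast
  qed (auto simp: F.ker_def)
  then have "inj_on ?F (carrier (localization R M))"
    by (intro F.Ke0_imp_inj) simp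
  moreover have "?F ` carrier (localization R M) = carrier (localization R N)"
  proof
    show "carrier (localization R N) \<subseteq> ?F ` carrier (localization R M)"
    proof
      fix w assume "w \<in> carrier (localization R N)"
      then obtain y s where "y \<in> carrier N" "s \<in> M.denominators" "w = mfrac R N y s"
        by (rule N.mfracE)
      moreover from this obtain x where "x \<in> carrier M" "y = f x"
        using assms by (auto simp: bij_betw_def)
      ultimately show "w \<in> ?F ` carrier (localization R M)"
        by (intro image_eqI[of _ _ "mfrac R M x s"]) (simp_all add: localization_map_mfrac)
    qed
  qed auto
  ultimately have bij: "bij_betw ?F (carrier (localization R M)) (carrier (localization R N))"
    by (simp add: bij_betw_def)
  note * = linear_bij_fin_dim[OF M.vectorspace_localization N.vectorspace_localization F.f_hom bij]
  show "has_finite_rank R M \<longleftrightarrow> has_finite_rank R N"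
    using *(1) by (simp add: M.has_finite_rank_iff N.has_finite_rank_iff)
  then show "has_finite_rank R N \<Longrightarrow> module_rank R M = module_rank R N"
    using *(2) N.has_finite_rank_iff by (simp add: M.module_rank_eq N.module_rank_eq)
qed

end

text \<open>Localization is exact: if \<open>g\<close> kills \<open>y / s\<close>, then it kills some \<open>u y\<close> with \<open>u \<noteq> 0\<close>, so
  \<open>u y = f x\<close> and \<open>y / s = f x / (u s)\<close>. The rank formula is then rank-nullity for the localized
  \<open>g\<close>, whose kernel is the image of the localized \<open>f\<close>.\<close>

lemma module_rank_exact:
  assumes R: "domain R"
    and L: "Module.module R L" and M: "Module.module R M" and N: "Module.module R N"
    and f: "f \<in> LinearCombinations.module_hom R L M" and g: "g \<in> LinearCombinations.module_hom R M N"
    and exact: "\<And>y. y \<in> carrier M \<Longrightarrow> g y = \<zero>\<^bsub>N\<^esub> \<longleftrightarrow> y \<in> f ` carrier L"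
    and fin: "has_finite_rank R M"
  shows "module_rank R M = map_rank R L M f + map_rank R M N g"
proof -
  interpret domain R by fact
  interpret L: module_over_domain R L by (intro module_over_domain.intro R L)
  interpret M: module_over_domain R M by (intro module_over_domain.intro R M)
  interpret N: module_over_domain R N by (intro module_over_domain.intro R N)
  interpret f: linear_map_over_domain R L M f
    using f by unfold_locales
  interpret g: linear_map_over_domain R M N g
    using g by unfold_locales
  let ?F = "localization_map R M f" and ?G = "localization_map R N g"
  interpret F: linear_map "quotient_field R" "localization R L" "localization R M" ?F
    by (rule f.linear_localization_map)
  interpret G: linear_map "quotient_field R" "localization R M" "localization R N" ?G
    by (rule g.linear_localization_map)
  have "G.ker = ?F ` carrier (localization R L)"
  proof (intro equalityI subsetI)
    fix w assume "w \<in> G.ker"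
    then have w: "w \<in> carrier (localization R M)" "?G w = \<zero>\<^bsub>localization R N\<^esub>"
      by (auto simp: G.ker_def)
    obtain y s where y: "y \<in> carrier M" "s \<in> denominators" "w = mfrac R M y s"
      using w(1) by (rule M.mfracE)
    then obtain u where u: "u \<in> denominators" "g (u \<odot>\<^bsub>M\<^esub> y) = \<zero>\<^bsub>N\<^esub>"
      using w(2) g.localization_map_eq_zero_iff by auto
    then obtain x where x: "x \<in> carrier L" "u \<odot>\<^bsub>M\<^esub> y = f x"
      using exact[of "u \<odot>\<^bsub>M\<^esub> y"] y by auto
    have "w = mfrac R M (u \<odot>\<^bsub>M\<^esub> y) (u \<otimes>\<^bsub>R\<^esub> s)"
      using y u M.mfrac_expand by simp
    also have "\<dots> = ?F (mfrac R L x (u \<otimes>\<^bsub>R\<^esub> s))"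
      using x y u by (simp add: f.localization_map_mfrac integral_iff)
    finally show "w \<in> ?F ` carrier (localization R L)"
      using x y u by (auto simp: integral_iff)
  next
    fix w assume "w \<in> ?F ` carrier (localization R L)"
    then obtain v where v: "v \<in> carrier (localization R L)" "w = ?F v"
      by blast
    obtain x s where x: "x \<in> carrier L" "s \<in> denominators" "v = mfrac R L x s"
      using v(1) by (rule L.mfracE)
    moreover have "g (f x) = \<zero>\<^bsub>N\<^esub>"
      using exact[of "f x"] x by auto
    ultimately show "w \<in> G.ker"
      using v by (simp add: G.ker_def f.localization_map_mfrac g.localization_map_mfrac N.mfrac_zero)
  qed
  then show ?thesis
    using G.rank_nullity fin M.has_finite_rank_iff
    by (simp add: M.module_rank_eq map_rank_def G.im_def)
qed

section \<open>Homology of chain complexes\<close>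

text \<open>A total additive relation whose only value at zero is zero is the graph of a linear map. This
  defines maps by diagram chases without choosing representatives.\<close>

lemma linear_map_of_relation:
  assumes "Module.module R H" "Module.module R K"
    and total: "\<And>x. x \<in> carrier H \<Longrightarrow> \<exists>y. D x y"
    and carr: "\<And>x y. D x y \<Longrightarrow> x \<in> carrier H \<and> y \<in> carrier K"
    and add: "\<And>x y x' y'. \<lbrakk>D x y; D x' y'\<rbrakk> \<Longrightarrow> D (x \<oplus>\<^bsub>H\<^esub> x') (y \<oplus>\<^bsub>K\<^esub> y')"
    and smult: "\<And>a x y. \<lbrakk>a \<in> carrier R; D x y\<rbrakk> \<Longrightarrow> D (a \<odot>\<^bsub>H\<^esub> x) (a \<odot>\<^bsub>K\<^esub> y)"
    and zero: "\<And>y. D \<zero>\<^bsub>H\<^esub> y \<Longrightarrow> y = \<zero>\<^bsub>K\<^esub>"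
  shows "\<exists>f. f \<in> LinearCombinations.module_hom R H K \<and> (\<forall>x y. D x y \<longleftrightarrow> x \<in> carrier H \<and> f x = y)"
proof -
  interpret H: Module.module R H by fact
  interpret K: Module.module R K by fact
  have unique: "y = y'" if D: "D x y" "D x y'" for x y y'
  proof -
    have c: "x \<in> carrier H" "y \<in> carrier K" "y' \<in> carrier K"
      using carr D by blast+
    have "D (x \<oplus>\<^bsub>H\<^esub> \<ominus>\<^bsub>R\<^esub> \<one>\<^bsub>R\<^esub> \<odot>\<^bsub>H\<^esub> x) (y \<oplus>\<^bsub>K\<^esub> \<ominus>\<^bsub>R\<^esub> \<one>\<^bsub>R\<^esub> \<odot>\<^bsub>K\<^esub> y')"
      using D by (intro add smult) simp_all
    then have "D \<zero>\<^bsub>H\<^esub> (y \<oplus>\<^bsub>K\<^esub> \<ominus>\<^bsub>K\<^esub> y')"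
      using c by (simp add: H.smult_minus_1 K.smult_minus_1 H.M.r_neg)
    then have "y \<oplus>\<^bsub>K\<^esub> \<ominus>\<^bsub>K\<^esub> y' = \<zero>\<^bsub>K\<^esub>"
      by (rule zero)
    then have "\<ominus>\<^bsub>K\<^esub> (\<ominus>\<^bsub>K\<^esub> y') = y"
      using c by (intro K.M.minus_equality) simp_all
    then show ?thesis
      using c by simp
  qed
  define f where "f x = (SOME y. D x y)" for x
  have D: "D x (f x)" if "x \<in> carrier H" for x
    unfolding f_def using total[OF that] by (rule someI_ex)
  have f: "f x = y" if "D x y" for x y
    using unique[OF D that] carr[OF that] by blast
  have "f \<in> LinearCombinations.module_hom R H K"
    unfolding LinearCombinations.module_hom_def
    using D carr f[OF add[OF D D]] f[OF smult[OF _ D]] by blast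
  moreover have "D x y \<longleftrightarrow> x \<in> carrier H \<and> f x = y" for x y
    using f D carr by blast
  ultimately show ?thesis
    by blast
qed

definition homology_class :: "('a, 'm) chain_complex \<Rightarrow> nat \<Rightarrow> 'm \<Rightarrow> 'm set" where
  "homology_class C n z = boundaries C n +>\<^bsub>chain_module C n\<^esub> z"

locale module_complex =
  fixes R :: "('a, 'z) ring_scheme" and C :: "('a, 'm) chain_complex"
  assumes is_complex: "is_chain_complex R C"
begin

lemma module: "Module.module R (chain_module C n)"
  using is_complex by (simp add: is_chain_complex_def)

lemma abelian_group: "abelian_group (chain_module C n)"
  using module by (simp add: Module.module_def)

lemma differential_hom:
  "differential C (Suc n) \<in> LinearCombinations.module_hom R (chain_module C (Suc n)) (chain_module C n)"
  using is_complex by (simp add: is_chain_complex_def)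

sublocale d: mod_hom R "chain_module C (Suc n)" "chain_module C n" "differential C (Suc n)" for n
  using module differential_hom by (intro mod_hom.intro mod_hom_axioms.intro)

lemma differential_differential:
  "x \<in> carrier (chain_module C (Suc (Suc n))) \<Longrightarrow>
    differential C (Suc n) (differential C (Suc (Suc n)) x) = \<zero>\<^bsub>chain_module C n\<^esub>"
  using is_complex by (simp add: is_chain_complex_def)

lemma mem_cycles_iff:
  "x \<in> cycles C n \<longleftrightarrow> x \<in> carrier (chain_module C n) \<and>
    (\<forall>k. n = Suc k \<longrightarrow> differential C (Suc k) x = \<zero>\<^bsub>chain_module C k\<^esub>)"
  by (cases n) (auto simp: cycles_def a_kernel_def')

lemma cycles_submodule: "LinearCombinations.submodule R (cycles C n) (chain_module C n)"
proof -
  interpret M: Module.module R "chain_module C n" by (rule module)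
  show ?thesis
    by (rule LinearCombinations.submodule.intro) (auto simp: mem_cycles_iff module)
qed

abbreviation cycle_module :: "nat \<Rightarrow> ('a, 'm) module" where
  "cycle_module n \<equiv> (chain_module C n)\<lparr>carrier := cycles C n\<rparr>"

lemma module_cycle_module: "Module.module R (cycle_module n)"
  using cycles_submodule by (rule d.N.submodule_is_module)

lemma boundaries_submodule: "LinearCombinations.submodule R (boundaries C n) (cycle_module n)"
proof -
  have "LinearCombinations.submodule R (boundaries C n) (chain_module C n)"
    using d.im_is_submodule[of n] by (simp add: d.im_def boundaries_def)
  moreover have "boundaries C n \<subseteq> cycles C n"
    using differential_differential by (auto simp: boundaries_def mem_cycles_iff)
  ultimately show ?thesis
    using module_cycle_module by (auto simp: LinearCombinations.submodule_def)
qed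

sublocale H: stable_subgroup R "cycle_module n" "boundaries C n" for n
  using module_cycle_module boundaries_submodule by (rule stable_subgroup_submodule)

lemma homology_class_eq_coset: "homology_class C n z = boundaries C n +>\<^bsub>cycle_module n\<^esub> z"
  by (simp add: homology_class_def a_r_coset_def r_coset_def)

lemma module_homology: "Module.module R (homology C n)"
  unfolding homology_def using module_cycle_module boundaries_submodule by (rule module_quotient_module)

lemma carrier_homology: "carrier (homology C n) = homology_class C n ` cycles C n"
  using H.quotient_module_carrier[of n] by (simp add: homology_def homology_class_eq_coset)

lemma homology_class_add:
  "\<lbrakk>x \<in> cycles C n; y \<in> cycles C n\<rbrakk> \<Longrightarrow>
    homology_class C n x \<oplus>\<^bsub>homology C n\<^esub> homology_class C n y = homology_class C n (x \<oplus>\<^bsub>chain_module C n\<^esub> y)"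
  using H.quotient_module_add[of x n y] by (simp add: homology_def homology_class_eq_coset)

lemma homology_class_smult:
  "\<lbrakk>a \<in> carrier R; x \<in> cycles C n\<rbrakk> \<Longrightarrow>
    a \<odot>\<^bsub>homology C n\<^esub> homology_class C n x = homology_class C n (a \<odot>\<^bsub>chain_module C n\<^esub> x)"
  using H.quotient_module_smult[of a x n] by (simp add: homology_def homology_class_eq_coset)

lemma homology_zero: "\<zero>\<^bsub>homology C n\<^esub> = homology_class C n \<zero>\<^bsub>chain_module C n\<^esub>"
  using H.quotient_module_zero[of n] by (simp add: homology_def homology_class_eq_coset)

lemma homology_class_eq_iff:
  assumes "x \<in> cycles C n" "y \<in> cycles C n"
  shows "homology_class C n x = homology_class C n y \<longleftrightarrow>
    (\<exists>w\<in>carrier (chain_module C (Suc n)). x = differential C (Suc n) w \<oplus>\<^bsub>chain_module C n\<^esub> y)"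
proof -
  interpret H': abelian_subgroup "boundaries C n" "cycle_module n"
    by (rule H.abelian_subgroup)
  have "homology_class C n x = homology_class C n y \<longleftrightarrow> x \<in> boundaries C n +>\<^bsub>cycle_module n\<^esub> y"
    unfolding homology_class_eq_coset
    using assms H'.a_repr_independence'[of x y] H'.a_repr_independenceD[of x y] by auto
  also have "\<dots> \<longleftrightarrow> (\<exists>w\<in>carrier (chain_module C (Suc n)). x = differential C (Suc n) w \<oplus>\<^bsub>chain_module C n\<^esub> y)"
    by (auto simp: a_r_coset_def' boundaries_def)
  finally show ?thesis .
qed

lemma homology_class_eq_zero_iff:
  assumes "x \<in> cycles C n"
  shows "homology_class C n x = \<zero>\<^bsub>homology C n\<^esub> \<longleftrightarrow> x \<in> boundaries C n"
proof -
  interpret M: Module.module R "chain_module C n" by (rule module)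
  have "\<zero>\<^bsub>chain_module C n\<^esub> \<in> cycles C n"
    by (auto simp: mem_cycles_iff)
  then show ?thesis
    using assms by (auto simp: homology_zero homology_class_eq_iff boundaries_def)
qed

end

locale complex_map = A: module_complex R A + B: module_complex R B
  for R :: "('a, 'z) ring_scheme" and A :: "('a, 'm) chain_complex" and B :: "('a, 'n) chain_complex"
    and f :: "nat \<Rightarrow> 'm \<Rightarrow> 'n" +
  assumes is_chain_map: "chain_map R A B f"
begin

lemma map_hom: "f n \<in> LinearCombinations.module_hom R (chain_module A n) (chain_module B n)"
  using is_chain_map by (simp add: chain_map_def)

sublocale f: mod_hom R "chain_module A n" "chain_module B n" "f n" for n
  using A.module B.module map_hom by (intro mod_hom.intro mod_hom_axioms.intro)

lemma map_differential:
  "x \<in> carrier (chain_module A (Suc n)) \<Longrightarrow> f n (differential A (Suc n) x) = differential B (Suc n) (f (Suc n) x)"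
  using is_chain_map by (simp add: chain_map_def)

lemma map_cycles: "x \<in> cycles A n \<Longrightarrow> f n x \<in> cycles B n"
  by (auto simp: A.mem_cycles_iff B.mem_cycles_iff simp flip: map_differential)

text \<open>Two representatives of a class differ by a boundary, which a chain map sends to a boundary.\<close>

lemma homology_map_class:
  assumes "x \<in> cycles A n"
  shows "homology_map B f n (homology_class A n x) = homology_class B n (f n x)"
  unfolding homology_map_def
proof (rule SUP_eq_const)
  have x: "x \<in> carrier (chain_module A n)"
    using assms by (simp add: A.mem_cycles_iff)
  interpret MA: Module.module R "chain_module A n" by (rule A.module)
  interpret MB: Module.module R "chain_module B n" by (rule B.module)
  have "\<zero>\<^bsub>chain_module A n\<^esub> \<in> boundaries A n"
    using LinearCombinations.submodule.zero_closed[OF A.boundaries_submodule] by simp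
  then show "homology_class A n x \<noteq> {}"
    by (auto simp: homology_class_def a_r_coset_def')
  fix z assume "z \<in> homology_class A n x"
  then obtain w where w: "w \<in> carrier (chain_module A (Suc n))"
      "z = differential A (Suc n) w \<oplus>\<^bsub>chain_module A n\<^esub> x"
    by (auto simp: homology_class_def a_r_coset_def' boundaries_def)
  have "differential A (Suc n) w \<in> cycles A n"
    using w(1) A.differential_differential by (auto simp: A.mem_cycles_iff)
  then have z: "z \<in> cycles A n"
    using w(2) assms LinearCombinations.submodule.m_closed[OF A.cycles_submodule] by simp
  have "f n z = differential B (Suc n) (f (Suc n) w) \<oplus>\<^bsub>chain_module B n\<^esub> f n x"
    using w x by (simp add: map_differential)
  then have "homology_class B n (f n z) = homology_class B n (f n x)"
    using B.homology_class_eq_iff[OF map_cycles[OF z] map_cycles[OF assms]] w(1) by (auto intro!: bexI[of _ "f (Suc n) w"])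
  then show "boundaries B n +>\<^bsub>chain_module B n\<^esub> f n z = homology_class B n (f n x)"
    by (simp add: homology_class_def)
qed

lemma homology_map_hom:
  "homology_map B f n \<in> LinearCombinations.module_hom R (homology A n) (homology B n)"
proof -
  have C: "x \<in> carrier (chain_module A n)" if "x \<in> cycles A n" for x
    using that by (simp add: A.mem_cycles_iff)
  have closed_add: "x \<oplus>\<^bsub>chain_module A n\<^esub> y \<in> cycles A n" if "x \<in> cycles A n" "y \<in> cycles A n" for x y
    using that LinearCombinations.submodule.m_closed[OF A.cycles_submodule] by simp
  have closed_smult: "a \<odot>\<^bsub>chain_module A n\<^esub> x \<in> cycles A n" if "x \<in> cycles A n" "a \<in> carrier R" for x a
    using that LinearCombinations.submodule.smult_closed[OF A.cycles_submodule] by simp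
  show ?thesis
    unfolding LinearCombinations.module_hom_def
  proof (intro CollectI conjI allI impI funcsetI; (elim conjE)?)
    fix U assume "U \<in> carrier (homology A n)"
    then show "homology_map B f n U \<in> carrier (homology B n)"
      using map_cycles by (auto simp: A.carrier_homology B.carrier_homology homology_map_class)
  next
    fix U V assume "U \<in> carrier (homology A n)" "V \<in> carrier (homology A n)"
    then obtain x y where xy: "x \<in> cycles A n" "y \<in> cycles A n" "U = homology_class A n x" "V = homology_class A n y"
      by (auto simp: A.carrier_homology)
    then show "homology_map B f n (U \<oplus>\<^bsub>homology A n\<^esub> V) = homology_map B f n U \<oplus>\<^bsub>homology B n\<^esub> homology_map B f n V"
      using xy map_cycles
      by (simp add: A.homology_class_add B.homology_class_add homology_map_class C closed_add)
  next
    fix a U assume a: "a \<in> carrier R" and "U \<in> carrier (homology A n)"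
    then obtain x where x: "x \<in> cycles A n" "U = homology_class A n x"
      by (auto simp: A.carrier_homology)
    then show "homology_map B f n (a \<odot>\<^bsub>homology A n\<^esub> U) = a \<odot>\<^bsub>homology B n\<^esub> homology_map B f n U"
      using a map_cycles
      by (simp add: A.homology_class_smult B.homology_class_smult homology_map_class C closed_smult)
  qed
qed

lemma quasi_isomorphism_rank:
  assumes "domain R" "quasi_isomorphism R A B f" "has_finite_rank R (homology B n)"
  shows "module_rank R (homology A n) = module_rank R (homology B n)"
proof -
  interpret domain R by fact
  interpret HA: module_over_domain R "homology A n" by (intro module_over_domain.intro assms(1) A.module_homology)
  interpret HB: module_over_domain R "homology B n" by (intro module_over_domain.intro assms(1) B.module_homology)
  interpret h: linear_map_over_domain R "homology A n" "homology B n" "homology_map B f n"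
    using homology_map_hom by unfold_locales
  show ?thesis
    using h.module_rank_bij(2) assms by (simp add: quasi_isomorphism_def)
qed

end

section \<open>The long exact homology sequence\<close>

lemma (in abelian_group) add_minus_cancel:
  "\<lbrakk>x \<in> carrier G; y \<in> carrier G\<rbrakk> \<Longrightarrow> y \<oplus> (x \<ominus> y) = x"
  by (simp add: minus_eq a_lcomm r_neg)

text \<open>The cokernel enters only through a surjection with kernel \<open>f(A)\<close>, because it is determined
  only up to isomorphism.\<close>

locale short_exact_sequence = f: complex_map R A B f + q: complex_map R B C q
  for R :: "('a, 'z) ring_scheme" and A :: "('a, 'm) chain_complex" and B :: "('a, 'n) chain_complex"
    and C :: "('a, 'o) chain_complex" and f q +
  assumes domain: "domain R"
    and f_inj: "inj_on (f n) (carrier (chain_module A n))"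
    and q_surj: "q n ` carrier (chain_module B n) = carrier (chain_module C n)"
    and exact: "b \<in> carrier (chain_module B n) \<Longrightarrow>
      q n b = \<zero>\<^bsub>chain_module C n\<^esub> \<longleftrightarrow> b \<in> f n ` carrier (chain_module A n)"
begin

lemma f_injD: "\<lbrakk>f n x = f n y; x \<in> carrier (chain_module A n); y \<in> carrier (chain_module A n)\<rbrakk> \<Longrightarrow> x = y"
  using f_inj by (rule inj_onD)

lemma q_f: "a \<in> carrier (chain_module A n) \<Longrightarrow> q n (f n a) = \<zero>\<^bsub>chain_module C n\<^esub>"
  using exact[of "f n a" n] by simp

lemma boundary_cycle:
  "b \<in> carrier (chain_module B (Suc n)) \<Longrightarrow> differential B (Suc n) b \<in> cycles B n"
  by (auto simp: f.B.mem_cycles_iff f.B.differential_differential)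

lemma cycle_if_image_cycle:
  assumes "a \<in> carrier (chain_module A n)" "f n a \<in> cycles B n"
  shows "a \<in> cycles A n"
  unfolding f.A.mem_cycles_iff
proof (intro conjI allI impI)
  fix k assume n: "n = Suc k"
  have "f k (differential A (Suc k) a) = f k \<zero>\<^bsub>chain_module A k\<^esub>"
    using assms n by (simp add: f.map_differential f.B.mem_cycles_iff)
  then show "differential A (Suc k) a = \<zero>\<^bsub>chain_module A k\<^esub>"
    by (rule f_injD) (use assms(1) n in simp_all)
qed (rule assms)

lemma boundary_lift:
  assumes "c \<in> boundaries C n"
  obtains b where "b \<in> carrier (chain_module B (Suc n))" "c = differential C (Suc n) (q (Suc n) b)"
  using assms by (auto simp: boundaries_def simp flip: q_surj)

text \<open>If \<open>q b\<close> bounds, lift the bounding chain to \<open>b'\<close>; then \<open>b - \<partial> b'\<close> is a cycle coming from \<open>A\<close>.\<close>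

lemma exact_at_B:
  assumes "V \<in> carrier (homology B n)"
  shows "homology_map C q n V = \<zero>\<^bsub>homology C n\<^esub> \<longleftrightarrow> V \<in> homology_map B f n ` carrier (homology A n)"
proof
  obtain b where b: "b \<in> cycles B n" "V = homology_class B n b"
    using assms by (auto simp: f.B.carrier_homology)
  then have bc: "b \<in> carrier (chain_module B n)"
    by (simp add: f.B.mem_cycles_iff)
  assume "homology_map C q n V = \<zero>\<^bsub>homology C n\<^esub>"
  then have "q n b \<in> boundaries C n"
    using b by (simp add: q.homology_map_class q.B.homology_class_eq_zero_iff q.map_cycles)
  then obtain b' where b': "b' \<in> carrier (chain_module B (Suc n))" "q n b = differential C (Suc n) (q (Suc n) b')"
    by (rule boundary_lift)
  let ?b = "b \<ominus>\<^bsub>chain_module B n\<^esub> differential B (Suc n) b'"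
  have "q n ?b = \<zero>\<^bsub>chain_module C n\<^esub>"
    using b' bc by (simp add: q.map_differential)
  then obtain a where a: "a \<in> carrier (chain_module A n)" "?b = f n a"
    using exact[of ?b n] b' bc by auto
  have eq: "b = differential B (Suc n) b' \<oplus>\<^bsub>chain_module B n\<^esub> f n a"
    unfolding a(2)[symmetric]
    by (rule abelian_group.add_minus_cancel[OF f.B.abelian_group bc f.B.d.f_im[OF b'(1)], symmetric])
  have "?b \<in> cycles B n"
    using b boundary_cycle[OF b'(1)] b' by (auto simp: f.B.mem_cycles_iff a_minus_def)
  then have ac: "a \<in> cycles A n" "f n a \<in> cycles B n"
    using a cycle_if_image_cycle by auto
  then have "V = homology_class B n (f n a)"
    using b b' eq f.B.homology_class_eq_iff by blast
  then have "V = homology_map B f n (homology_class A n a)"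
    using ac by (simp add: f.homology_map_class)
  then show "V \<in> homology_map B f n ` carrier (homology A n)"
    using ac by (auto simp: f.A.carrier_homology)
next
  assume "V \<in> homology_map B f n ` carrier (homology A n)"
  then obtain a where a: "a \<in> cycles A n" "V = homology_map B f n (homology_class A n a)"
    by (auto simp: f.A.carrier_homology)
  moreover from this have "a \<in> carrier (chain_module A n)"
    by (simp add: f.A.mem_cycles_iff)
  ultimately show "homology_map C q n V = \<zero>\<^bsub>homology C n\<^esub>"
    by (simp add: f.homology_map_class q.homology_map_class f.map_cycles q_f q.B.homology_zero)
qed

text \<open>The snake relation: lift a cycle of \<open>C\<close> to a chain \<open>b\<close> of \<open>B\<close>; its boundary comes from a cycle
  of \<open>A\<close>.\<close>

definition connecting :: "nat \<Rightarrow> 'o set \<Rightarrow> 'm set \<Rightarrow> bool" where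
  "connecting n U V \<longleftrightarrow> (\<exists>b\<in>carrier (chain_module B (Suc n)). \<exists>a\<in>carrier (chain_module A n).
     f n a = differential B (Suc n) b \<and> U = homology_class C (Suc n) (q (Suc n) b) \<and> V = homology_class A n a)"

lemma connecting_cycles:
  assumes "b \<in> carrier (chain_module B (Suc n))" "a \<in> carrier (chain_module A n)"
    "f n a = differential B (Suc n) b"
  shows "a \<in> cycles A n" "q (Suc n) b \<in> cycles C (Suc n)"
proof -
  show "a \<in> cycles A n"
    using assms boundary_cycle cycle_if_image_cycle by simp
  have "differential C (Suc n) (q (Suc n) b) = \<zero>\<^bsub>chain_module C n\<^esub>"
    using assms q_f[of a n] by (simp add: q.map_differential[symmetric])
  then show "q (Suc n) b \<in> cycles C (Suc n)"
    using assms by (simp add: q.B.mem_cycles_iff)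
qed

lemma connecting_total:
  assumes "U \<in> carrier (homology C (Suc n))"
  shows "\<exists>V. connecting n U V"
proof -
  obtain c where c: "c \<in> cycles C (Suc n)" "U = homology_class C (Suc n) c"
    using assms by (auto simp: q.B.carrier_homology)
  then have "c \<in> carrier (chain_module C (Suc n))"
    by (simp add: q.B.mem_cycles_iff)
  then obtain b where b: "b \<in> carrier (chain_module B (Suc n))" "c = q (Suc n) b"
    using q_surj[of "Suc n"] by blast
  then have "q n (differential B (Suc n) b) = \<zero>\<^bsub>chain_module C n\<^esub>"
    using c by (simp add: q.map_differential q.B.mem_cycles_iff)
  then obtain a where "a \<in> carrier (chain_module A n)" "f n a = differential B (Suc n) b"
    using exact[of "differential B (Suc n) b" n] b by auto
  then show ?thesis
    using b c by (auto simp: connecting_def)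
qed

lemma connecting_add:
  assumes "connecting n U V" "connecting n U' V'"
  shows "connecting n (U \<oplus>\<^bsub>homology C (Suc n)\<^esub> U') (V \<oplus>\<^bsub>homology A n\<^esub> V')"
proof -
  obtain b a b' a' where *: "b \<in> carrier (chain_module B (Suc n))" "a \<in> carrier (chain_module A n)"
      "f n a = differential B (Suc n) b" "b' \<in> carrier (chain_module B (Suc n))"
      "a' \<in> carrier (chain_module A n)" "f n a' = differential B (Suc n) b'"
    and UV: "U = homology_class C (Suc n) (q (Suc n) b)" "V = homology_class A n a"
      "U' = homology_class C (Suc n) (q (Suc n) b')" "V' = homology_class A n a'"
    using assms unfolding connecting_def by blast
  have "U \<oplus>\<^bsub>homology C (Suc n)\<^esub> U' = homology_class C (Suc n) (q (Suc n) (b \<oplus>\<^bsub>chain_module B (Suc n)\<^esub> b'))"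
    "V \<oplus>\<^bsub>homology A n\<^esub> V' = homology_class A n (a \<oplus>\<^bsub>chain_module A n\<^esub> a')"
    using * connecting_cycles[of b n a] connecting_cycles[of b' n a']
    by (simp_all add: UV q.B.homology_class_add f.A.homology_class_add)
  then show ?thesis
    unfolding connecting_def using *
    by (intro bexI[of _ "b \<oplus>\<^bsub>chain_module B (Suc n)\<^esub> b'"] bexI[of _ "a \<oplus>\<^bsub>chain_module A n\<^esub> a'"]) simp_all
qed

lemma connecting_smult:
  assumes r: "r \<in> carrier R" and "connecting n U V"
  shows "connecting n (r \<odot>\<^bsub>homology C (Suc n)\<^esub> U) (r \<odot>\<^bsub>homology A n\<^esub> V)"
proof -
  obtain b a where *: "b \<in> carrier (chain_module B (Suc n))" "a \<in> carrier (chain_module A n)"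
      "f n a = differential B (Suc n) b"
    and UV: "U = homology_class C (Suc n) (q (Suc n) b)" "V = homology_class A n a"
    using assms unfolding connecting_def by blast
  have "r \<odot>\<^bsub>homology C (Suc n)\<^esub> U = homology_class C (Suc n) (q (Suc n) (r \<odot>\<^bsub>chain_module B (Suc n)\<^esub> b))"
    "r \<odot>\<^bsub>homology A n\<^esub> V = homology_class A n (r \<odot>\<^bsub>chain_module A n\<^esub> a)"
    using * r connecting_cycles[of b n a]
    by (simp_all add: UV q.B.homology_class_smult f.A.homology_class_smult)
  then show ?thesis
    unfolding connecting_def using * r
    by (intro bexI[of _ "r \<odot>\<^bsub>chain_module B (Suc n)\<^esub> b"] bexI[of _ "r \<odot>\<^bsub>chain_module A n\<^esub> a"]) simp_all
qed

text \<open>This is the step that makes the connecting homomorphism well defined: if \<open>q b\<close> bounds, subtract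
  from \<open>b\<close> the boundary of a lift of the bounding chain. The difference lies in \<open>A\<close>, and its boundary
  is the given cycle.\<close>

lemma connecting_zero:
  assumes "connecting n \<zero>\<^bsub>homology C (Suc n)\<^esub> V"
  shows "V = \<zero>\<^bsub>homology A n\<^esub>"
proof -
  obtain b a where *: "b \<in> carrier (chain_module B (Suc n))" "a \<in> carrier (chain_module A n)"
      "f n a = differential B (Suc n) b"
    and U: "\<zero>\<^bsub>homology C (Suc n)\<^esub> = homology_class C (Suc n) (q (Suc n) b)" and V: "V = homology_class A n a"
    using assms unfolding connecting_def by blast
  have "q (Suc n) b \<in> boundaries C (Suc n)"
    using connecting_cycles(2)[OF *] q.B.homology_class_eq_zero_iff[THEN iffD1, OF _ U[symmetric]] by blast
  then obtain b' where b': "b' \<in> carrier (chain_module B (Suc (Suc n)))"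
      "q (Suc n) b = differential C (Suc (Suc n)) (q (Suc (Suc n)) b')"
    by (rule boundary_lift)
  let ?b = "b \<ominus>\<^bsub>chain_module B (Suc n)\<^esub> differential B (Suc (Suc n)) b'"
  have "q (Suc n) ?b = \<zero>\<^bsub>chain_module C (Suc n)\<^esub>"
    using b' * by (simp add: q.map_differential)
  then obtain a' where a': "a' \<in> carrier (chain_module A (Suc n))" "?b = f (Suc n) a'"
    using exact[of ?b "Suc n"] b' * by auto
  have "f n (differential A (Suc n) a') = differential B (Suc n) ?b"
    using a' by (simp add: f.map_differential)
  also have "\<dots> = f n a"
    using b' * by (simp add: f.B.differential_differential) (simp add: a_minus_def)
  finally have "differential A (Suc n) a' = a"
    using a' * by (intro f_injD[of n]) simp_all
  then have "a \<in> boundaries A n"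
    using a' by (auto simp: boundaries_def)
  then show ?thesis
    using V connecting_cycles[OF *] f.A.homology_class_eq_zero_iff by simp
qed

lemma connecting_carrier:
  assumes "connecting n U V"
  shows "U \<in> carrier (homology C (Suc n)) \<and> V \<in> carrier (homology A n)"
  using assms connecting_cycles by (auto simp: connecting_def q.B.carrier_homology f.A.carrier_homology)

lemma connecting_image:
  assumes "V \<in> carrier (homology A n)"
  shows "homology_map B f n V = \<zero>\<^bsub>homology B n\<^esub> \<longleftrightarrow> (\<exists>U. connecting n U V)"
proof
  obtain a where a: "a \<in> cycles A n" "V = homology_class A n a"
    using assms by (auto simp: f.A.carrier_homology)
  assume "homology_map B f n V = \<zero>\<^bsub>homology B n\<^esub>"
  then have "f n a \<in> boundaries B n"
    using a by (simp add: f.homology_map_class f.B.homology_class_eq_zero_iff f.map_cycles)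
  then show "\<exists>U. connecting n U V"
    using a by (auto simp: connecting_def boundaries_def f.A.mem_cycles_iff)
next
  assume "\<exists>U. connecting n U V"
  then obtain b a where *: "b \<in> carrier (chain_module B (Suc n))" "a \<in> carrier (chain_module A n)"
      "f n a = differential B (Suc n) b" and V: "V = homology_class A n a"
    unfolding connecting_def by blast
  have "f n a \<in> boundaries B n"
    using * by (auto simp: boundaries_def)
  then show "homology_map B f n V = \<zero>\<^bsub>homology B n\<^esub>"
    using V connecting_cycles[OF *] by (simp add: f.homology_map_class f.B.homology_class_eq_zero_iff f.map_cycles)
qed

lemma connecting_kernel:
  assumes "U \<in> carrier (homology C (Suc n))"
  shows "connecting n U \<zero>\<^bsub>homology A n\<^esub> \<longleftrightarrow> U \<in> homology_map C q (Suc n) ` carrier (homology B (Suc n))"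
proof
  assume "connecting n U \<zero>\<^bsub>homology A n\<^esub>"
  then obtain b a where *: "b \<in> carrier (chain_module B (Suc n))" "a \<in> carrier (chain_module A n)"
      "f n a = differential B (Suc n) b"
    and U: "U = homology_class C (Suc n) (q (Suc n) b)" and a: "\<zero>\<^bsub>homology A n\<^esub> = homology_class A n a"
    unfolding connecting_def by blast
  have "a \<in> boundaries A n"
    using connecting_cycles(1)[OF *] f.A.homology_class_eq_zero_iff[THEN iffD1, OF _ a[symmetric]] by blast
  then obtain a' where a': "a' \<in> carrier (chain_module A (Suc n))" "a = differential A (Suc n) a'"
    by (auto simp: boundaries_def)
  let ?b = "b \<ominus>\<^bsub>chain_module B (Suc n)\<^esub> f (Suc n) a'"
  have "differential B (Suc n) ?b = \<zero>\<^bsub>chain_module B n\<^esub>"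
    using * a' by (simp add: f.map_differential[symmetric])
  then have "?b \<in> cycles B (Suc n)"
    using * a' by (simp add: f.B.mem_cycles_iff)
  moreover have "q (Suc n) ?b = q (Suc n) b"
    using * a' by (simp add: q_f) (simp add: a_minus_def)
  ultimately have "U = homology_map C q (Suc n) (homology_class B (Suc n) ?b)"
    using U by (simp add: q.homology_map_class)
  then show "U \<in> homology_map C q (Suc n) ` carrier (homology B (Suc n))"
    using \<open>?b \<in> cycles B (Suc n)\<close> by (simp add: f.B.carrier_homology)
next
  assume "U \<in> homology_map C q (Suc n) ` carrier (homology B (Suc n))"
  then obtain b where b: "b \<in> cycles B (Suc n)" "U = homology_class C (Suc n) (q (Suc n) b)"
    by (auto simp: f.B.carrier_homology q.homology_map_class)
  then show "connecting n U \<zero>\<^bsub>homology A n\<^esub>"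
    unfolding connecting_def f.A.homology_zero f.B.mem_cycles_iff
    by (intro bexI[of _ b] bexI[of _ "\<zero>\<^bsub>chain_module A n\<^esub>"]) simp_all
qed

lemma homology_map_surj_0: "homology_map C q 0 ` carrier (homology B 0) = carrier (homology C 0)"
proof -
  have "cycles C 0 = q 0 ` cycles B 0"
    using q_surj[of 0] by (simp add: cycles_def)
  then show ?thesis
    by (simp add: q.B.carrier_homology f.B.carrier_homology image_image q.homology_map_class cong: image_cong)
qed

text \<open>Here \<open>d n\<close> is the rank of the connecting homomorphism \<open>H\<^bsub>n+1\<^esub>(C) \<rightarrow> H\<^sub>n(A)\<close>. Every term of the
  long exact sequence has as rank the sum of the ranks of its two adjacent maps, and the ranks of
  \<open>H\<^sub>n(A) \<rightarrow> H\<^sub>n(B)\<close> and \<open>H\<^sub>n(B) \<rightarrow> H\<^sub>n(C)\<close> cancel.\<close>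

lemma homology_rank_relation:
  assumes fin: "\<And>n. has_finite_rank R (homology A n)" "\<And>n. has_finite_rank R (homology B n)"
    "\<And>n. has_finite_rank R (homology C n)"
  obtains d where "\<And>n. d n \<le> module_rank R (homology A n)"
    "\<And>n. module_rank R (homology B n) + d n + (case n of 0 \<Rightarrow> 0 | Suc k \<Rightarrow> d k)
       = module_rank R (homology A n) + module_rank R (homology C n)"
proof -
  have "\<exists>\<delta>. \<delta> \<in> LinearCombinations.module_hom R (homology C (Suc n)) (homology A n) \<and>
     (\<forall>U V. connecting n U V \<longleftrightarrow> U \<in> carrier (homology C (Suc n)) \<and> \<delta> U = V)" for n
    by (rule linear_map_of_relation[OF q.B.module_homology f.A.module_homology])
      (fact connecting_total connecting_carrier connecting_add connecting_smult connecting_zero)+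
  then obtain \<delta> where \<delta>: "\<And>n. \<delta> n \<in> LinearCombinations.module_hom R (homology C (Suc n)) (homology A n)"
    and conn: "\<And>n U V. connecting n U V \<longleftrightarrow> U \<in> carrier (homology C (Suc n)) \<and> \<delta> n U = V"
    by metis
  let ?i = "\<lambda>n. map_rank R (homology A n) (homology B n) (homology_map B f n)"
  let ?p = "\<lambda>n. map_rank R (homology B n) (homology C n) (homology_map C q n)"
  define d where "d n = map_rank R (homology C (Suc n)) (homology A n) (\<delta> n)" for n
  have A: "module_rank R (homology A n) = d n + ?i n" for n
    unfolding d_def
    by (rule module_rank_exact[OF domain q.B.module_homology f.A.module_homology f.B.module_homology \<delta>
          f.homology_map_hom _ fin(1)])
      (auto simp: connecting_image conn)
  have B: "module_rank R (homology B n) = ?i n + ?p n" for n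
    by (rule module_rank_exact[OF domain f.A.module_homology f.B.module_homology q.B.module_homology
          f.homology_map_hom q.homology_map_hom exact_at_B fin(2)])
  have C: "module_rank R (homology C (Suc n)) = ?p (Suc n) + d n" for n
    unfolding d_def
    by (rule module_rank_exact[OF domain f.B.module_homology q.B.module_homology f.A.module_homology
          q.homology_map_hom \<delta> _ fin(3)])
      (simp add: connecting_kernel[symmetric] conn)
  interpret H0: linear_map_over_domain R "homology B 0" "homology C 0" "homology_map C q 0"
    using domain f.B.module_homology q.B.module_homology q.homology_map_hom
    by (intro linear_map_over_domain.intro module_over_domain.intro mod_hom.intro mod_hom_axioms.intro)
  have C0: "module_rank R (homology C 0) = ?p 0"
    using H0.map_rank_surj[OF homology_map_surj_0 fin(3)] by simp
  show ?thesis
  proof (rule that[of d])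
    fix n
    show "d n \<le> module_rank R (homology A n)"
      by (simp add: A)
    show "module_rank R (homology B n) + d n + (case n of 0 \<Rightarrow> 0 | Suc k \<Rightarrow> d k)
       = module_rank R (homology A n) + module_rank R (homology C n)"
      by (cases n) (simp_all add: A B C C0)
  qed
qed

end

lemma short_exact_sequence_cokernel:
  assumes R: "domain R" and A: "is_chain_complex R A" and B: "is_chain_complex R B" and C: "is_chain_complex R C"
    and f: "cofibration R A B f" and g: "chain_isomorphism R (cokernel A B f) C g"
  shows "short_exact_sequence R A B C f
    (\<lambda>n b. g n ((f n ` carrier (chain_module A n)) +>\<^bsub>chain_module B n\<^esub> b))"
proof -
  interpret f: complex_map R A B f
    using A B f by (intro complex_map.intro module_complex.intro complex_map_axioms.intro) (auto simp: cofibration_def)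
  interpret C: module_complex R C
    using C by (rule module_complex.intro)
  let ?N = "\<lambda>n. f n ` carrier (chain_module A n)"
  let ?\<pi> = "\<lambda>n b. ?N n +>\<^bsub>chain_module B n\<^esub> b"
  let ?q = "\<lambda>n b. g n (?\<pi> n b)"
  have "LinearCombinations.submodule R (?N n) (chain_module B n)" for n
    using f.f.im_is_submodule[of n] by (simp add: f.f.im_def)
  then interpret N: stable_subgroup R "chain_module B n" "?N n" for n
    using f.B.module by (intro stable_subgroup_submodule)
  interpret MB: Module.module R "chain_module B n" for n by (rule f.B.module)
  interpret MC: Module.module R "chain_module C n" for n by (rule C.module)
  have cok: "chain_module (cokernel A B f) n = quotient_module (chain_module B n) (?N n)" for n
    by (simp add: cokernel_def)
  have g_hom: "g n \<in> LinearCombinations.module_hom R (quotient_module (chain_module B n) (?N n)) (chain_module C n)"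
    and g_bij: "bij_betw (g n) (carrier (quotient_module (chain_module B n) (?N n))) (carrier (chain_module C n))" for n
    using g by (simp_all add: chain_isomorphism_def chain_map_def cok)
  have \<pi>_carrier: "?\<pi> n b \<in> carrier (quotient_module (chain_module B n) (?N n))"
    if "b \<in> carrier (chain_module B n)" for n b
    using that by (simp add: N.quotient_module_carrier)
  have d_\<pi>: "differential (cokernel A B f) (Suc n) (?\<pi> (Suc n) b) = ?\<pi> n (differential B (Suc n) b)"
    if b: "b \<in> carrier (chain_module B (Suc n))" for n b
  proof -
    have "(\<Union>x\<in>?\<pi> (Suc n) b. ?\<pi> n (differential B (Suc n) x)) = ?\<pi> n (differential B (Suc n) b)"
    proof (rule SUP_eq_const)
      show "?\<pi> (Suc n) b \<noteq> {}"
        using abelian_subgroup.a_rcos_self[OF N.abelian_subgroup] b by blast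
      fix x assume "x \<in> ?\<pi> (Suc n) b"
      then obtain a where a: "a \<in> carrier (chain_module A (Suc n))"
          "x = f (Suc n) a \<oplus>\<^bsub>chain_module B (Suc n)\<^esub> b"
        by (auto simp: a_r_coset_def')
      then have "differential B (Suc n) x
          = f n (differential A (Suc n) a) \<oplus>\<^bsub>chain_module B n\<^esub> differential B (Suc n) b"
        using b by (simp add: f.map_differential)
      then have "differential B (Suc n) x \<in> ?\<pi> n (differential B (Suc n) b)"
        using a by (auto simp: a_r_coset_def')
      then show "?\<pi> n (differential B (Suc n) x) = ?\<pi> n (differential B (Suc n) b)"
        using abelian_subgroup.a_repr_independence'[OF N.abelian_subgroup] b by (metis f.B.d.f_im)
    qed
    then show ?thesis
      by (simp add: cokernel_def)
  qed
  have q_hom: "?q n \<in> LinearCombinations.module_hom R (chain_module B n) (chain_module C n)" for n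
    unfolding LinearCombinations.module_hom_def
  proof (intro CollectI conjI allI impI funcsetI; (elim conjE)?)
    fix b assume "b \<in> carrier (chain_module B n)"
    then show "?q n b \<in> carrier (chain_module C n)"
      using \<pi>_carrier LinearCombinations.module_hom_closed[OF g_hom] by blast
  next
    fix b b' assume "b \<in> carrier (chain_module B n)" "b' \<in> carrier (chain_module B n)"
    then show "?q n (b \<oplus>\<^bsub>chain_module B n\<^esub> b') = ?q n b \<oplus>\<^bsub>chain_module C n\<^esub> ?q n b'"
      using LinearCombinations.module_hom_add[OF g_hom \<pi>_carrier \<pi>_carrier] by (simp add: N.quotient_module_add)
  next
    fix r b assume "r \<in> carrier R" "b \<in> carrier (chain_module B n)"
    then show "?q n (r \<odot>\<^bsub>chain_module B n\<^esub> b) = r \<odot>\<^bsub>chain_module C n\<^esub> ?q n b"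
      using LinearCombinations.module_hom_smult[OF g_hom _ \<pi>_carrier] by (simp add: N.quotient_module_smult)
  qed
  have "?q n (differential B (Suc n) b) = differential C (Suc n) (?q (Suc n) b)"
    if "b \<in> carrier (chain_module B (Suc n))" for n b
    using g \<pi>_carrier[OF that] d_\<pi>[OF that] unfolding chain_isomorphism_def chain_map_def cok by metis
  then have "chain_map R B C ?q"
    using q_hom by (simp add: chain_map_def)
  then interpret q: complex_map R B C ?q
    by (intro complex_map.intro f.B.module_complex_axioms C.module_complex_axioms complex_map_axioms.intro)
  show ?thesis
  proof (intro short_exact_sequence.intro short_exact_sequence_axioms.intro
      f.complex_map_axioms q.complex_map_axioms R)
    fix n
    show "inj_on (f n) (carrier (chain_module A n))"
      using f by (simp add: cofibration_def)
    show "?q n ` carrier (chain_module B n) = carrier (chain_module C n)"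
      using g_bij[of n] by (simp add: bij_betw_def N.quotient_module_carrier image_image)
  next
    fix b n assume b: "b \<in> carrier (chain_module B n)"
    have "?q n b = \<zero>\<^bsub>chain_module C n\<^esub> \<longleftrightarrow> ?q n b = ?q n \<zero>\<^bsub>chain_module B n\<^esub>"
      by simp
    also have "\<dots> \<longleftrightarrow> ?\<pi> n b = ?\<pi> n \<zero>\<^bsub>chain_module B n\<^esub>"
      using b by (intro inj_on_eq_iff[OF bij_betw_imp_inj_on[OF g_bij]] \<pi>_carrier) simp_all
    also have "\<dots> \<longleftrightarrow> b \<in> ?N n"
      using b abelian_group.add_minus_cancel[OF f.B.abelian_group b, of "\<zero>\<^bsub>chain_module B n\<^esub>"]
      by (simp add: N.coset_eq_iff)
    finally show "?q n b = \<zero>\<^bsub>chain_module C n\<^esub> \<longleftrightarrow> b \<in> ?N n" .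
  qed
qed

section \<open>Abel limits\<close>

lemma power_series_summable:
  fixes a :: "nat \<Rightarrow> real"
  assumes "conv_radius a \<ge> 1" "\<bar>x\<bar> < 1"
  shows "summable (\<lambda>k. \<bar>a k\<bar> * \<bar>x\<bar> ^ k)"
proof -
  have "ereal (norm x) < 1"
    using assms(2) by (simp add: one_ereal_def)
  then have "ereal (norm x) < conv_radius a"
    using assms(1) by (rule less_le_trans)
  then show ?thesis
    using abs_summable_in_conv_radius[of x a] by (simp add: abs_mult power_abs)
qed

lemma power_series_summable':
  fixes a e :: "nat \<Rightarrow> real"
  assumes "conv_radius a \<ge> 1" "0 \<le> x" "x < 1" and bound: "\<And>n. \<bar>e n\<bar> \<le> \<bar>a n\<bar>"
  shows "summable (\<lambda>k. e k * x ^ k)" and "\<bar>suminf (\<lambda>k. e k * x ^ k)\<bar> \<le> suminf (\<lambda>k. \<bar>a k\<bar> * x ^ k)"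
proof -
  have a: "summable (\<lambda>k. \<bar>a k\<bar> * x ^ k)"
    using power_series_summable[OF assms(1), of x] assms by simp
  have le: "norm (e k * x ^ k) \<le> \<bar>a k\<bar> * x ^ k" for k
    using bound assms by (simp add: abs_mult power_abs mult_right_mono)
  then have e: "summable (\<lambda>k. \<bar>e k * x ^ k\<bar>)"
    using a summable_comparison_test'[of _ 0 "\<lambda>k. \<bar>e k * x ^ k\<bar>"] by simp
  then show "summable (\<lambda>k. e k * x ^ k)"
    by (rule summable_rabs_cancel)
  have "\<bar>suminf (\<lambda>k. e k * x ^ k)\<bar> \<le> suminf (\<lambda>k. \<bar>e k * x ^ k\<bar>)"
    using e by (rule summable_rabs)
  also have "\<dots> \<le> suminf (\<lambda>k. \<bar>a k\<bar> * x ^ k)"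
    using le by (intro suminf_le e a) simp
  finally show "\<bar>suminf (\<lambda>k. e k * x ^ k)\<bar> \<le> suminf (\<lambda>k. \<bar>a k\<bar> * x ^ k)" .
qed

text \<open>The telescoping correction \<open>e n - e (n - 1)\<close> changes the power series by
  \<open>(1 - x) * suminf (\<lambda>k. e k * x ^ k)\<close>. After multiplication by another \<open>1 - x\<close> it is dominated by the quantity that
  controlled absolute growth of \<open>a\<close> sends to zero.\<close>

lemma abel_limit_additive:
  fixes a b c e :: "nat \<Rightarrow> real"
  assumes radius: "conv_radius a \<ge> 1" "conv_radius c \<ge> 1"
    and a: "((\<lambda>x. (1 - x) * suminf (\<lambda>k. a k * x ^ k)) \<longlongrightarrow> \<alpha>) (at_left 1)"
    and c: "((\<lambda>x. (1 - x) * suminf (\<lambda>k. c k * x ^ k)) \<longlongrightarrow> \<gamma>) (at_left 1)"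
    and growth: "controlled_absolute_growth a"
    and bound: "\<And>n. \<bar>e n\<bar> \<le> \<bar>a n\<bar>"
    and rel: "\<And>n. b n = a n + c n - e n + (case n of 0 \<Rightarrow> 0 | Suc k \<Rightarrow> e k)"
  shows "((\<lambda>x. (1 - x) * suminf (\<lambda>k. b k * x ^ k)) \<longlongrightarrow> \<alpha> + \<gamma>) (at_left 1)"
proof -
  have ev: "eventually (\<lambda>x::real. 0 < x \<and> x < 1) (at_left 1)"
    using eventually_at_left_real[of 0 1] by (auto elim: eventually_mono)
  have sum_eq: "(1 - x) * suminf (\<lambda>k. b k * x ^ k)
      = (1 - x) * suminf (\<lambda>k. a k * x ^ k) + (1 - x) * suminf (\<lambda>k. c k * x ^ k) - (1 - x)\<^sup>2 * suminf (\<lambda>k. e k * x ^ k)"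
    if x: "0 < x \<and> x < 1" for x
  proof -
    have A: "(\<lambda>k. a k * x ^ k) sums suminf (\<lambda>k. a k * x ^ k)"
      and C: "(\<lambda>k. c k * x ^ k) sums suminf (\<lambda>k. c k * x ^ k)"
      and E: "(\<lambda>k. e k * x ^ k) sums suminf (\<lambda>k. e k * x ^ k)"
      using power_series_summable'(1)[OF radius(1), of x a] power_series_summable'(1)[OF radius(2), of x c]
        power_series_summable'(1)[OF radius(1), of x e] x bound by (auto intro: summable_sums)
    have "(\<lambda>n. (case Suc n of 0 \<Rightarrow> 0 | Suc k \<Rightarrow> e k) * x ^ Suc n) sums (x * suminf (\<lambda>k. e k * x ^ k))"
      using sums_mult[OF E, of x] by (simp add: mult_ac)
    then have S: "(\<lambda>n. (case n of 0 \<Rightarrow> 0 | Suc k \<Rightarrow> e k) * x ^ n) sums (x * suminf (\<lambda>k. e k * x ^ k))"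
      by (subst (asm) sums_Suc_iff) simp
    have "(\<lambda>k. a k * x ^ k + c k * x ^ k - e k * x ^ k + (case k of 0 \<Rightarrow> 0 | Suc k \<Rightarrow> e k) * x ^ k) sums
        (suminf (\<lambda>k. a k * x ^ k) + suminf (\<lambda>k. c k * x ^ k) - suminf (\<lambda>k. e k * x ^ k) + x * suminf (\<lambda>k. e k * x ^ k))"
      by (intro sums_add sums_diff A C E S)
    then have "(\<lambda>k. b k * x ^ k) sums
        (suminf (\<lambda>k. a k * x ^ k) + suminf (\<lambda>k. c k * x ^ k) - suminf (\<lambda>k. e k * x ^ k) + x * suminf (\<lambda>k. e k * x ^ k))"
      by (simp add: rel algebra_simps)
    then show ?thesis
      by (simp only: sums_unique[symmetric]) (simp add: algebra_simps power2_eq_square)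
  qed
  have "((\<lambda>x. (1 - x)\<^sup>2 * suminf (\<lambda>k. e k * x ^ k)) \<longlongrightarrow> 0) (at_left 1)"
  proof (rule Lim_null_comparison)
    show "((\<lambda>x. (1 - x)\<^sup>2 * suminf (\<lambda>k. \<bar>a k\<bar> * x ^ k)) \<longlongrightarrow> 0) (at_left 1)"
      using growth by (simp add: controlled_absolute_growth_def)
    show "\<forall>\<^sub>F x in at_left 1. norm ((1 - x)\<^sup>2 * suminf (\<lambda>k. e k * x ^ k)) \<le> (1 - x)\<^sup>2 * suminf (\<lambda>k. \<bar>a k\<bar> * x ^ k)"
      using ev
    proof eventually_elim
      case (elim x)
      then show ?case
        using power_series_summable'(2)[OF radius(1) _ _ bound, of x] by (simp add: abs_mult mult_left_mono)
    qed
  qed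
  then have "((\<lambda>x. (1 - x) * suminf (\<lambda>k. a k * x ^ k) + (1 - x) * suminf (\<lambda>k. c k * x ^ k)
      - (1 - x)\<^sup>2 * suminf (\<lambda>k. e k * x ^ k)) \<longlongrightarrow> \<alpha> + \<gamma> - 0) (at_left 1)"
    by (intro tendsto_add tendsto_diff a c)
  moreover have "eventually (\<lambda>x. (1 - x) * suminf (\<lambda>k. a k * x ^ k) + (1 - x) * suminf (\<lambda>k. c k * x ^ k)
      - (1 - x)\<^sup>2 * suminf (\<lambda>k. e k * x ^ k) = (1 - x) * suminf (\<lambda>k. b k * x ^ k)) (at_left 1)"
    using ev by eventually_elim (simp add: sum_eq)
  ultimately show ?thesis
    by (simp add: tendsto_cong)
qed

section \<open>The Abel Euler characteristic on the Grothendieck group\<close>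

text \<open>The Abel sum regularises the alternating sum of the ranks of infinitely many homology modules.\<close>

definition abel_euler_characteristic :: "('a, 'z) ring_scheme \<Rightarrow> ('a, 'm) chain_complex \<Rightarrow> real" where
  "abel_euler_characteristic R C =
     Lim (at_left 1) (\<lambda>x. (1 - x) * suminf (\<lambda>k. homology_sequence R C k * x ^ k))"

lemma abel_euler_characteristic_eq:
  "((\<lambda>x. (1 - x) * suminf (\<lambda>k. homology_sequence R C k * x ^ k)) \<longlongrightarrow> l) (at_left 1) \<Longrightarrow>
    abel_euler_characteristic R C = l"
  unfolding abel_euler_characteristic_def by (rule tendsto_Lim) simp

lemma abel_euler_characteristic_limit:
  assumes "C \<in> abel_complexes R"
  shows "((\<lambda>x. (1 - x) * suminf (\<lambda>k. homology_sequence R C k * x ^ k)) \<longlongrightarrow> abel_euler_characteristic R C) (at_left 1)"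
  using assms abel_euler_characteristic_eq by (fastforce simp: abel_complexes_def abel_sequence_def)

lemma abel_euler_characteristic_quasi_isomorphism:
  assumes "domain R" "A \<in> abel_complexes R" "B \<in> abel_complexes R" "quasi_isomorphism R A B f"
  shows "abel_euler_characteristic R A = abel_euler_characteristic R B"
proof -
  interpret complex_map R A B f
    using assms by (intro complex_map.intro module_complex.intro complex_map_axioms.intro)
      (auto simp: abel_complexes_def quasi_isomorphism_def)
  have "homology_sequence R A = homology_sequence R B"
    using quasi_isomorphism_rank[OF assms(1,4)] assms(3) by (auto simp: homology_sequence_def abel_complexes_def)
  then show ?thesis
    by (simp add: abel_euler_characteristic_def)
qed

text \<open>The signed ranks \<open>(-1)\<^sup>n d\<^sub>n\<close> of the connecting homomorphisms measure the failure of the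
  homology sequences to add up. They telescope, and \<open>d\<^sub>n\<close> is at most the rank of \<open>H\<^sub>n(A)\<close>.\<close>

lemma abel_euler_characteristic_cofibration:
  assumes R: "domain R" and A: "A \<in> abel_complexes R" and B: "B \<in> abel_complexes R" and C: "C \<in> abel_complexes R"
    and fg: "cofibration R A B f" "chain_isomorphism R (cokernel A B f) C g"
  shows "abel_euler_characteristic R B = abel_euler_characteristic R A + abel_euler_characteristic R C"
proof -
  obtain q where "short_exact_sequence R A B C f q"
    using short_exact_sequence_cokernel[OF R _ _ _ fg] A B C by (auto simp: abel_complexes_def)
  then interpret short_exact_sequence R A B C f q .
  obtain d where d: "\<And>n. d n \<le> module_rank R (homology A n)"
    "\<And>n. module_rank R (homology B n) + d n + (case n of 0 \<Rightarrow> 0 | Suc k \<Rightarrow> d k)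
       = module_rank R (homology A n) + module_rank R (homology C n)"
    using homology_rank_relation A B C unfolding abel_complexes_def by blast
  let ?h = "homology_sequence R" and ?e = "\<lambda>n. (-1) ^ n * real (d n)"
  have "((\<lambda>x. (1 - x) * suminf (\<lambda>k. ?h B k * x ^ k)) \<longlongrightarrow>
      abel_euler_characteristic R A + abel_euler_characteristic R C) (at_left 1)"
  proof (rule abel_limit_additive[OF _ _ abel_euler_characteristic_limit[OF A] abel_euler_characteristic_limit[OF C]])
    show "conv_radius (?h A) \<ge> 1" "conv_radius (?h C) \<ge> 1" "controlled_absolute_growth (?h A)"
      using A C by (simp_all add: abel_complexes_def abel_sequence_def)
    fix n
    show "\<bar>?e n\<bar> \<le> \<bar>?h A n\<bar>"
      using d(1) by (simp add: homology_sequence_def abs_mult power_abs)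
    have rank_B: "real (module_rank R (homology B n)) = real (module_rank R (homology A n))
        + real (module_rank R (homology C n)) - real (d n) - (case n of 0 \<Rightarrow> 0 | Suc k \<Rightarrow> real (d k))"
      using arg_cong[OF d(2)[of n], of real] by (cases n) simp_all
    show "?h B n = ?h A n + ?h C n - ?e n + (case n of 0 \<Rightarrow> 0 | Suc k \<Rightarrow> ?e k)"
      unfolding homology_sequence_def rank_B by (cases n) (simp_all add: algebra_simps)
  qed
  then show ?thesis
    by (rule abel_euler_characteristic_eq)
qed

text \<open>The additive extension of a weight on generators to the free abelian group on them.\<close>

definition frag_sum :: "('c \<Rightarrow> real) \<Rightarrow> ('c \<Rightarrow>\<^sub>0 int) \<Rightarrow> real" where
  "frag_sum w c = (\<Sum>k\<in>Poly_Mapping.keys c. of_int (Poly_Mapping.lookup c k) * w k)"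

lemma frag_sum_superset:
  assumes "finite S" "Poly_Mapping.keys c \<subseteq> S"
  shows "frag_sum w c = (\<Sum>k\<in>S. of_int (Poly_Mapping.lookup c k) * w k)"
  unfolding frag_sum_def using assms by (intro sum.mono_neutral_left) (auto simp: in_keys_iff)

lemma frag_sum_add: "frag_sum w (c + d) = frag_sum w c + frag_sum w d"
proof -
  let ?S = "Poly_Mapping.keys c \<union> Poly_Mapping.keys d"
  have "frag_sum w c' = (\<Sum>k\<in>?S. of_int (Poly_Mapping.lookup c' k) * w k)" if "c' \<in> {c, d, c + d}" for c'
    using that keys_add[of c d] by (intro frag_sum_superset) auto
  then show ?thesis
    by (simp add: Poly_Mapping.lookup_add distrib_right sum.distrib)
qed

lemma frag_sum_cmul: "frag_sum w (frag_cmul n c) = of_int n * frag_sum w c"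
proof -
  have "frag_sum w (frag_cmul n c) = (\<Sum>k\<in>Poly_Mapping.keys c. of_int (Poly_Mapping.lookup (frag_cmul n c) k) * w k)"
    using keys_cmul by (intro frag_sum_superset) auto
  then show ?thesis
    by (simp add: frag_sum_def sum_distrib_left mult_ac)
qed

lemma frag_sum_uminus: "frag_sum w (- c) = - frag_sum w c"
  using frag_sum_cmul[of w "-1" c] by simp

lemma frag_sum_diff: "frag_sum w (c - d) = frag_sum w c - frag_sum w d"
  using frag_sum_add[of w c "- d"] frag_sum_uminus[of w d] by simp

lemma frag_sum_of: "frag_sum w (frag_of x) = w x"
  by (simp add: frag_sum_def)

lemma K0_relations_subset: "K0_relations R \<subseteq> carrier (free_Abelian_group (abel_complexes R))"
proof
  fix c :: "('a, 'm) chain_complex \<Rightarrow>\<^sub>0 int"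
  have sub: "Poly_Mapping.keys (a - b) \<subseteq> S" "Poly_Mapping.keys (a + b) \<subseteq> S"
    if "Poly_Mapping.keys a \<subseteq> S" "Poly_Mapping.keys b \<subseteq> S"
    for a b :: "('a, 'm) chain_complex \<Rightarrow>\<^sub>0 int" and S
    using that keys_diff[of a b] keys_add[of a b] by blast+
  assume "c \<in> K0_relations R"
  then show "c \<in> carrier (free_Abelian_group (abel_complexes R))"
    unfolding K0_relations_def carrier_free_Abelian_group_iff
    by (elim UnE CollectE exE conjE; hypsubst; intro sub; simp)
qed

lemma normal_K0_subgroup: "K0_subgroup R \<lhd> free_Abelian_group (abel_complexes R)"
  unfolding K0_subgroup_def using K0_relations_subset
  by (intro comm_group.normal_iff_subgroup[THEN iffD2] abelian_free_Abelian_group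
      group.generate_is_subgroup group_free_Abelian_group)

lemma frag_sum_K0_subgroup:
  assumes "domain R" "c \<in> K0_subgroup R"
  shows "frag_sum (abel_euler_characteristic R) c = 0"
proof -
  have rel: "frag_sum (abel_euler_characteristic R) c = 0" if "c \<in> K0_relations R" for c
    using that unfolding K0_relations_def
  proof (elim UnE CollectE exE conjE)
    fix A A' f assume "c = frag_of A - frag_of A'" "A \<in> abel_complexes R" "A' \<in> abel_complexes R"
      "quasi_isomorphism R A A' f"
    then show ?thesis
      using abel_euler_characteristic_quasi_isomorphism[OF assms(1)] by (simp add: frag_sum_diff frag_sum_of)
  next
    fix A B C f g assume "c = frag_of B - (frag_of A + frag_of C)"
      "A \<in> abel_complexes R" "B \<in> abel_complexes R" "C \<in> abel_complexes R"
      "cofibration R A B f" "chain_isomorphism R (cokernel A B f) C g"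
    then show ?thesis
      using abel_euler_characteristic_cofibration[OF assms(1)]
      by (simp add: frag_sum_diff frag_sum_add frag_sum_of)
  qed
  from assms(2) show ?thesis
    unfolding K0_subgroup_def
  proof (induction rule: generate.induct)
    case one
    then show ?case by (simp add: frag_sum_def)
  next
    case (incl c)
    then show ?case by (rule rel)
  next
    case (inv c)
    then have "c \<in> carrier (free_Abelian_group (abel_complexes R))"
      by (rule subsetD[OF K0_relations_subset])
    then show ?case
      using rel[OF inv] by (simp add: frag_sum_uminus)
  next
    case (eng c d)
    then show ?case by (simp add: frag_sum_add)
  qed
qed

lemma (in group) infinite_cyclic_subgroup:
  assumes x: "x \<in> carrier G" and "\<And>n::int. x [^] n = \<one> \<Longrightarrow> n = 0"
  shows "subgroup_generated G {x} \<cong> integer_group"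
proof -
  let ?S = "subgroup_generated G {x}"
  have "inj (\<lambda>n::int. x [^] n)"
  proof (rule injI)
    fix m n :: int assume "x [^] m = x [^] n"
    then have "x [^] (m - n) = \<one>"
      using x by (simp add: int_pow_diff)
    then show "m = n"
      using assms(2) by force
  qed
  then have "(\<lambda>n::int. x [^] n) \<in> iso integer_group ?S"
    unfolding iso_def bij_betw_def hom_def using x
    by (auto simp: carrier_subgroup_generated_by_singleton int_pow_mult)
  then show ?thesis
    using group.iso_sym[OF group_integer_group] is_isoI by blast
qed

text \<open>A relation \<open>n [C] = 0\<close> places \<open>n C\<close> in the subgroup of relations, where the extended Euler
  characteristic vanishes; its value there is \<open>n\<close> times that of \<open>C\<close>.\<close>

lemma K0_class_infinite_cyclic:
  assumes R: "domain R" and C: "C \<in> abel_complexes R" and nz: "abel_euler_characteristic R C \<noteq> 0"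
  shows "K0_class R C \<in> carrier (K0_abel R) \<and> subgroup_generated (K0_abel R) {K0_class R C} \<cong> integer_group"
proof -
  let ?F = "free_Abelian_group (abel_complexes R)" and ?N = "K0_subgroup R"
  interpret N: normal ?N ?F
    by (rule normal_K0_subgroup)
  interpret G: group "K0_abel R"
    unfolding K0_abel_def by (rule N.factorgroup_is_group)
  have mem: "frag_of C \<in> carrier ?F"
    using C by simp
  then have carr: "K0_class R C \<in> carrier (K0_abel R)"
    by (simp add: K0_class_def K0_abel_def FactGroup_def N.rcosetsI N.subset)
  moreover have "n = 0" if "K0_class R C [^]\<^bsub>K0_abel R\<^esub> n = \<one>\<^bsub>K0_abel R\<^esub>" for n :: int
  proof -
    have "?N #>\<^bsub>?F\<^esub> (frag_of C [^]\<^bsub>?F\<^esub> n) = ?N"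
      using that N.FactGroup_int_pow[OF mem, of n] by (simp add: K0_class_def K0_abel_def FactGroup_def)
    then have "frag_of C [^]\<^bsub>?F\<^esub> n \<in> ?N"
      using N.coset_join1 N.int_pow_closed[OF mem] N.subgroup_axioms by metis
    then have "frag_cmul n (frag_of C) \<in> ?N"
      using C by simp
    then have "of_int n * abel_euler_characteristic R C = 0"
      using frag_sum_K0_subgroup[OF R] by (metis frag_sum_cmul frag_sum_of)
    then show "n = 0"
      using nz by simp
  qed
  ultimately show ?thesis
    using G.infinite_cyclic_subgroup by blast
qed

section \<open>The complex with the ring in every even degree\<close>

locale embedded_domain = domain R for R (structure) +
  fixes e :: "'a \<Rightarrow> 'm"
  assumes inj: "inj_on e (carrier R)"
begin

lemma regular_module_simps:
  "carrier (regular_module R e) = e ` carrier R"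
  "\<lbrakk>a \<in> carrier R; b \<in> carrier R\<rbrakk> \<Longrightarrow> e a \<oplus>\<^bsub>regular_module R e\<^esub> e b = e (a \<oplus> b)"
  "\<lbrakk>a \<in> carrier R; b \<in> carrier R\<rbrakk> \<Longrightarrow> a \<odot>\<^bsub>regular_module R e\<^esub> e b = e (a \<otimes> b)"
  "\<zero>\<^bsub>regular_module R e\<^esub> = e \<zero>"
  using inj by (simp_all add: regular_module_def Let_def)

lemma module_regular_module: "Module.module R (regular_module R e)"
proof (rule Module.moduleI)
  show "abelian_group (regular_module R e)"
  proof (rule abelian_groupI)
    fix x assume "x \<in> carrier (regular_module R e)"
    then obtain a where "a \<in> carrier R" "x = e a"
      by (auto simp: regular_module_simps)
    then show "\<exists>y\<in>carrier (regular_module R e). y \<oplus>\<^bsub>regular_module R e\<^esub> x = \<zero>\<^bsub>regular_module R e\<^esub>"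
      by (intro bexI[of _ "e (\<ominus> a)"]) (simp_all add: regular_module_simps l_neg)
  qed (auto simp: regular_module_simps a_ac)
qed (auto simp: regular_module_simps is_cring l_distr r_distr m_assoc)

lemma Xi_module:
  "chain_module (Xi_ring R e) n =
     (regular_module R e)\<lparr>carrier := if even n then e ` carrier R else {e \<zero>}\<rparr>"
  by (simp add: Xi_ring_def regular_module_simps(1)[symmetric])

lemma Xi_differential: "differential (Xi_ring R e) n x = e \<zero>"
  by (simp add: Xi_ring_def)

lemma module_Xi: "Module.module R (chain_module (Xi_ring R e) n)"
proof -
  interpret M: Module.module R "regular_module R e" by (rule module_regular_module)
  have "LinearCombinations.submodule R (if even n then e ` carrier R else {e \<zero>}) (regular_module R e)"
    by (rule LinearCombinations.submodule.intro)
      (auto simp: module_regular_module regular_module_simps split: if_splits)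
  then show ?thesis
    unfolding Xi_module by (rule M.submodule_is_module)
qed

sublocale Xi: module_complex R "Xi_ring R e"
proof (rule module_complex.intro, unfold is_chain_complex_def, intro conjI allI ballI module_Xi)
  fix n
  show "differential (Xi_ring R e) (Suc n) \<in> LinearCombinations.module_hom R
      (chain_module (Xi_ring R e) (Suc n)) (chain_module (Xi_ring R e) n)"
    by (auto simp: LinearCombinations.module_hom_def Xi_differential Xi_module regular_module_simps)
qed (simp add: Xi_differential Xi_module regular_module_simps)

lemma Xi_cycles: "cycles (Xi_ring R e) n = carrier (chain_module (Xi_ring R e) n)"
  by (auto simp: Xi.mem_cycles_iff Xi_differential Xi_module regular_module_simps)

text \<open>All differentials vanish, so taking homology classes is an isomorphism from the chain module to
  the homology module.\<close>

lemma Xi_homology_rank: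
  "has_finite_rank R (homology (Xi_ring R e) n) \<longleftrightarrow> has_finite_rank R (chain_module (Xi_ring R e) n)"
  "has_finite_rank R (homology (Xi_ring R e) n) \<Longrightarrow>
    module_rank R (homology (Xi_ring R e) n) = module_rank R (chain_module (Xi_ring R e) n)"
proof -
  let ?M = "chain_module (Xi_ring R e) n" and ?H = "homology (Xi_ring R e) n"
  let ?c = "homology_class (Xi_ring R e) n"
  have hom: "?c \<in> LinearCombinations.module_hom R ?M ?H"
    unfolding LinearCombinations.module_hom_def
    using Xi.homology_class_add Xi.homology_class_smult by (auto simp: Xi.carrier_homology Xi_cycles)
  interpret c: linear_map_over_domain R ?M ?H ?c
    using domain_axioms module_Xi Xi.module_homology hom
    by (intro linear_map_over_domain.intro module_over_domain.intro mod_hom.intro mod_hom_axioms.intro)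
  have "x = y" if xy: "x \<in> carrier ?M" "y \<in> carrier ?M" "?c x = ?c y" for x y
  proof -
    obtain w where "x = differential (Xi_ring R e) (Suc n) w \<oplus>\<^bsub>?M\<^esub> y"
      using xy Xi.homology_class_eq_iff[of x n y] by (auto simp: Xi_cycles)
    moreover have "e \<zero> = \<zero>\<^bsub>?M\<^esub>"
      by (simp add: Xi_module regular_module_simps)
    ultimately show ?thesis
      using xy(2) by (simp add: Xi_differential)
  qed
  then have "bij_betw ?c (carrier ?M) (carrier ?H)"
    by (auto simp: bij_betw_def inj_on_def Xi.carrier_homology Xi_cycles)
  then show "has_finite_rank R ?H \<longleftrightarrow> has_finite_rank R ?M"
    "has_finite_rank R ?H \<Longrightarrow> module_rank R ?H = module_rank R ?M"
    using c.module_rank_bij by simp_all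
qed

end

lemma (in vectorspace) fin_dim_generated_by:
  assumes v: "v \<in> carrier V" and gen: "\<And>w. w \<in> carrier V \<Longrightarrow> \<exists>q\<in>carrier K. w = q \<odot>\<^bsub>V\<^esub> v"
  shows "gen_set {v}" and "fin_dim"
proof -
  have sub: "LinearCombinations.submodule K (span {v}) V"
    using v by (intro span_is_submodule) simp
  have "v \<in> span {v}"
    using v in_own_span[of "{v}"] by simp
  then have "w \<in> span {v}" if "w \<in> carrier V" for w
    using gen[OF that] LinearCombinations.submodule.smult_closed[OF sub] by auto
  then show "gen_set {v}"
    using LinearCombinations.submodule.subset[OF sub] by blast
  then show "fin_dim"
    using v unfolding fin_dim_def by (intro exI[of _ "{v}"]) simp
qed

context embedded_domain
begin

text \<open>In even degrees \<open>1 / 1\<close> spans the localization, and it is nonzero because \<open>R\<close> has no zero divisors.\<close>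

lemma Xi_chain_module_rank:
  "has_finite_rank R (chain_module (Xi_ring R e) n)"
  "module_rank R (chain_module (Xi_ring R e) n) = (if even n then 1 else 0)"
proof -
  let ?M = "chain_module (Xi_ring R e) n"
  interpret M: module_over_domain R ?M
    by (intro module_over_domain.intro domain_axioms module_Xi)
  interpret L: vectorspace "quotient_field R" "localization R ?M"
    by (rule M.vectorspace_localization)
  have zero: "\<zero>\<^bsub>?M\<^esub> = e \<zero>"
    by (simp add: Xi_module regular_module_simps)
  have "has_finite_rank R ?M \<and> module_rank R ?M = (if even n then 1 else 0)"
  proof (cases "even n")
    case True
    let ?v = "mfrac R ?M (e \<one>) \<one>"
    have one: "e \<one> \<in> carrier ?M"
      using True by (simp add: Xi_module)
    then have v: "?v \<in> carrier (localization R ?M)"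
      by simp
    have smult: "r \<odot>\<^bsub>?M\<^esub> e \<one> = e r" if "r \<in> carrier R" for r
      using that by (simp add: Xi_module regular_module_simps)
    have "\<exists>q\<in>carrier (quotient_field R). w = q \<odot>\<^bsub>localization R ?M\<^esub> ?v" if w: "w \<in> carrier (localization R ?M)" for w
    proof -
      obtain x s where x: "x \<in> carrier ?M" "s \<in> denominators" "w = mfrac R ?M x s"
        using w by (rule M.mfracE)
      moreover from this obtain r where "r \<in> carrier R" "x = e r"
        using True by (auto simp: Xi_module)
      ultimately show ?thesis
        using one by (intro bexI[of _ "fraction R r s"]) (simp_all add: M.mfrac_smult smult)
    qed
    note gen = L.fin_dim_generated_by[OF v this]
    have "?v \<noteq> \<zero>\<^bsub>localization R ?M\<^esub>"
    proof
      assume "?v = \<zero>\<^bsub>localization R ?M\<^esub>"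
      then obtain u where u: "u \<in> denominators" "u \<odot>\<^bsub>?M\<^esub> e \<one> = \<zero>\<^bsub>?M\<^esub>"
        using M.mfrac_eq_zero_iff[of "e \<one>" \<one>] True by (auto simp: Xi_module)
      then have "e u = e \<zero>"
        by (simp add: smult zero)
      then show False
        using u inj by (auto dest: inj_onD)
    qed
    then show ?thesis
      using gen v L.dim1I True by (simp add: M.has_finite_rank_iff M.module_rank_eq)
  next
    case False
    have "w = \<zero>\<^bsub>quotient_field R\<^esub> \<odot>\<^bsub>localization R ?M\<^esub> \<zero>\<^bsub>localization R ?M\<^esub>"
      if w: "w \<in> carrier (localization R ?M)" for w
    proof -
      obtain x s where x: "x \<in> carrier ?M" "s \<in> denominators" "w = mfrac R ?M x s"
        using w by (rule M.mfracE)
      then have "x = \<zero>\<^bsub>?M\<^esub>"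
        using False unfolding zero by (simp add: Xi_module)
      then have "w = \<zero>\<^bsub>localization R ?M\<^esub>"
        using M.mfrac_zero[OF x(2)] x(3) by (simp only:)
      then show ?thesis
        by (simp only: L.smult_l_null[OF L.M.zero_closed])
    qed
    then have "\<exists>q\<in>carrier (quotient_field R). w = q \<odot>\<^bsub>localization R ?M\<^esub> \<zero>\<^bsub>localization R ?M\<^esub>"
      if w: "w \<in> carrier (localization R ?M)" for w
      using w by (intro bexI[of _ "\<zero>\<^bsub>quotient_field R\<^esub>"]) simp_all
    note gen = L.fin_dim_generated_by[OF L.M.zero_closed this]
    then show ?thesis
      using L.dim0I False by (simp add: M.has_finite_rank_iff M.module_rank_eq)
  qed
  then show "has_finite_rank R ?M" "module_rank R ?M = (if even n then 1 else 0)"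
    by auto
qed

lemma homology_sequence_Xi: "homology_sequence R (Xi_ring R e) n = (if even n then 1 else 0)"
  using Xi_homology_rank Xi_chain_module_rank by (simp add: homology_sequence_def)

text \<open>The coefficients \<open>1, 0, 1, 0, \<dots>\<close> are the averages of those of the geometric series in \<open>x\<close> and
  in \<open>-x\<close>.\<close>

lemma Xi_power_series:
  assumes "\<bar>x\<bar> < 1"
  shows "(\<lambda>n. homology_sequence R (Xi_ring R e) n * x ^ n) sums (1 / ((1 - x) * (1 + x)))"
proof -
  have "(\<lambda>n. (x ^ n + (- x) ^ n) / 2) sums ((1 / (1 - x) + 1 / (1 - (- x))) / 2)"
    using assms by (intro sums_divide sums_add geometric_sums) simp_all
  moreover have "(x ^ n + (- x) ^ n) / 2 = homology_sequence R (Xi_ring R e) n * x ^ n" for n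
    by (simp add: homology_sequence_Xi)
  moreover have "(1 / (1 - x) + 1 / (1 - (- x))) / 2 = 1 / ((1 - x) * (1 + x))"
    using assms by (simp add: field_simps abs_if split: if_splits)
  ultimately show ?thesis
    by simp
qed

lemma Xi_limits:
  "((\<lambda>x. (1 - x) * suminf (\<lambda>k. homology_sequence R (Xi_ring R e) k * x ^ k)) \<longlongrightarrow> 1 / 2) (at_left 1)"
  "((\<lambda>x. (1 - x)\<^sup>2 * suminf (\<lambda>k. \<bar>homology_sequence R (Xi_ring R e) k\<bar> * x ^ k)) \<longlongrightarrow> 0) (at_left 1)"
proof -
  have ev: "eventually (\<lambda>x::real. 0 < x \<and> x < 1) (at_left 1)"
    using eventually_at_left_real[of 0 1] by (auto elim: eventually_mono)
  have abs: "\<bar>homology_sequence R (Xi_ring R e) k\<bar> = homology_sequence R (Xi_ring R e) k" for k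
    by (simp add: homology_sequence_Xi)
  have series: "suminf (\<lambda>k. homology_sequence R (Xi_ring R e) k * x ^ k) = 1 / ((1 - x) * (1 + x))"
    if "0 < x \<and> x < 1" for x
    using that Xi_power_series[of x] by (simp add: sums_iff)
  have "((\<lambda>x::real. 1 / (1 + x)) \<longlongrightarrow> 1 / (1 + 1)) (at_left 1)"
    by (intro tendsto_intros) simp
  moreover have "eventually (\<lambda>x. (1 - x) * suminf (\<lambda>k. homology_sequence R (Xi_ring R e) k * x ^ k) = 1 / (1 + x)) (at_left 1)"
    using ev by eventually_elim (simp add: series)
  ultimately show "((\<lambda>x. (1 - x) * suminf (\<lambda>k. homology_sequence R (Xi_ring R e) k * x ^ k)) \<longlongrightarrow> 1 / 2) (at_left 1)"
    by (simp add: tendsto_cong)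
  have "((\<lambda>x::real. (1 - x) / (1 + x)) \<longlongrightarrow> (1 - 1) / (1 + 1)) (at_left 1)"
    by (intro tendsto_intros) simp
  moreover have "eventually (\<lambda>x. (1 - x)\<^sup>2 * suminf (\<lambda>k. \<bar>homology_sequence R (Xi_ring R e) k\<bar> * x ^ k) = (1 - x) / (1 + x)) (at_left 1)"
    using ev by eventually_elim (simp add: abs series power2_eq_square)
  ultimately show "((\<lambda>x. (1 - x)\<^sup>2 * suminf (\<lambda>k. \<bar>homology_sequence R (Xi_ring R e) k\<bar> * x ^ k)) \<longlongrightarrow> 0) (at_left 1)"
    by (simp add: tendsto_cong)
qed

lemma Xi_abel_complex: "Xi_ring R e \<in> abel_complexes R"
proof -
  have "conv_radius (homology_sequence R (Xi_ring R e)) \<ge> 1"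
  proof (rule conv_radius_geI_ex)
    fix r :: real assume "0 < r" "ereal r < 1"
    then show "\<exists>z. norm z = r \<and> summable (\<lambda>n. homology_sequence R (Xi_ring R e) n * z ^ n)"
      using Xi_power_series[of r] by (intro exI[of _ r]) (simp add: sums_iff)
  qed
  then show ?thesis
    using Xi.is_complex Xi_homology_rank(1) Xi_chain_module_rank(1) Xi_limits
    by (auto simp: abel_complexes_def abel_sequence_def controlled_absolute_growth_def)
qed

end

theorem theorem8p1:
  fixes R :: "('a, 'z) ring_scheme" and e :: "'a \<Rightarrow> 'm"
  assumes "noetherian_domain R"
    and "inj_on e (carrier R)"
  shows "K0_class R (Xi_ring R e) \<in> carrier (K0_abel R) \<and>
    subgroup_generated (K0_abel R) {K0_class R (Xi_ring R e)} \<cong> integer_group"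
proof -
  have domain: "domain R"
    using assms(1) by (rule noetherian_domain.axioms)
  interpret embedded_domain R e
    using domain assms(2) by (intro embedded_domain.intro embedded_domain_axioms.intro)
  show ?thesis
    using K0_class_infinite_cyclic[OF domain Xi_abel_complex] abel_euler_characteristic_eq[OF Xi_limits(1)] by simp
qed

end
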